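(* Let $f:\mathcal M\to\mathbb R$ satisfy the following assumptions. (A1) $f$ is continuously differentiable and is lower bounded, i.e. $f(x^* )>-\infty$, where $x^*$ is an optimal solution of $\min_{x\in\mathcal M}f(x)$. (A2) $f$ has $H$-bounded Riemannian stochastic gradient: $\|\mathrm{grad} f_i(x)\|_F\le H$, or equivalently $\|\mathbf g_i(x)\|_2\le H$. (A3) $f$ is upper-Hessian bounded, with constant $L>0$, with respect to the retraction $R$. Let $\{x_t\}$ and $\{\hat{\mathbf v}_t\}$ be the sequences obtained from the RASA algorithm (described in the context), where $\hat{\mathbf v}_t=\hat{\mathbf r}_t^{1/2}\otimes\hat{\mathbf l}_t^{1/2}$. Then $$\mathbb E\left[\sum_{t=2}^T\alpha_{t-1}\left\langle \mathbf g(x_t),\frac{\mathbf g(x_t)}{\sqrt{\hat{\mathbf v}_{t-1}}}\right\rangle_2\right]\le \mathbb E\left[\frac L2\sum_{t=1}^T\left\|\frac{\alpha_t\,\mathbf g_t(x_t)}{\sqrt{\hat{\mathbf v}_t}}\right\|_2^2+H^2\sum_{t=2}^T\left\|\frac{\alpha_t}{\sqrt{\hat{\mathbf v}_t}}-\frac{\alpha_{t-1}}{\sqrt{\hat{\mathbf v}_{t-1}}}\right\|_1\right]+C,$$ where $C$ is a constant term independent of $T$, and square roots and divisions of vectors are element-wise.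
   Context: Setting. $\mathcal M$ is a Riemannian manifold whose elements are represented as real matrices of size $n\times r$, with Riemannian metric given by the Euclidean inner product, $\langle\xi,\eta\rangle_x=\langle\xi,\eta\rangle_2$, and norm $\|\xi\|_x=\|\xi\|_2$, for $\xi,\eta\in T_x\mathcal M$. $\mathcal P_x$ is the linear operator projecting (orthogonally) onto the tangent space $T_x\mathcal M$, and $R_x:T_x\mathcal M\to\mathcal M$ is a retraction. $\mathrm{grad} f(x)\in T_x\mathcal M$ is the Riemannian gradient. Stochastic gradients. $\mathrm{grad} f_i(x)\in T_x\mathcal M$ denotes a Riemannian stochastic gradient, typically the Riemannian gradient of the objective on a batch of data $y_i$; as a stochastic gradient of $f$ it satisfies $\mathbb E_i[\mathrm{grad} f_i(x)]=\mathrm{grad} f(x)$. The one used at iteration $t$ is written $\mathrm{grad} f_t(x)$. $\mathbf g_t(x)=\mathrm{vec}(\mathrm{grad} f_t(x))\in\mathbb R^{nr}$ and $\mathbf g(x)=\mathrm{vec}(\mathrm{grad} f(x))\in\mathbb R^{nr}$ are the vectorized representations. $\mathbb E$ is expectation over the random draws. RASA algorithm. Inputs: step sizes $\{\alpha_t\}_{t=1}^T$, $\alpha_t>0$, and a hyper-parameter $\beta\in(0,1)$. Initialize $x_1\in\mathcal M$, $\mathbf l_0=\hat{\mathbf l}_0=\mathbf 0\in\mathbb R^n$, $\mathbf r_0=\hat{\mathbf r}_0=\mathbf 0\in\mathbb R^r$. For $t=1,2,\dots,T$: set $\mathbf G_t=\mathrm{grad} f_t(x_t)\in\mathbb R^{n\times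 r}$; $\mathbf l_t=\beta\mathbf l_{t-1}+(1-\beta)\,\mathrm{diag}(\mathbf G_t\mathbf G_t^\top)/r$; $\hat{\mathbf l}_t=\max(\hat{\mathbf l}_{t-1},\mathbf l_t)$; $\mathbf r_t=\beta\mathbf r_{t-1}+(1-\beta)\,\mathrm{diag}(\mathbf G_t^\top\mathbf G_t)/n$; $\hat{\mathbf r}_t=\max(\hat{\mathbf r}_{t-1},\mathbf r_t)$; and $$x_{t+1}=R_{x_t}\left(-\alpha_t\,\mathcal P_{x_t}\left(\mathrm{Diag}(\hat{\mathbf l}_t^{-1/4})\,\mathbf G_t\,\mathrm{Diag}(\hat{\mathbf r}_t^{-1/4})\right)\right).$$ Here $\mathrm{diag}(\cdot)$ is the diagonal vector of a square matrix, $\mathrm{Diag}(\cdot)$ the diagonal matrix with given diagonal, max and powers of vectors are element-wise, and $\otimes$ is the Kronecker product. In vectorized form, $x_{t+1}=R_{x_t}(-\alpha_t\mathcal P_{x_t}(\mathrm{Diag}(\hat{\mathbf v}_t)^{-1/2}\mathbf g_t(x_t)))$ with $\hat{\mathbf v}_t=\hat{\mathbf r}_t^{1/2}\otimes\hat{\mathbf l}_t^{1/2}\in\mathbb R^{nr}$. Upper-Hessian bounded. $f$ is upper-Hessian bounded in $\mathcal U\subset\mathcal M$ with respect to $R$ if there is a constant $L>0$ such that $\frac{d^2 f(R_x(t\eta))}{dt^2}\le L$ for all $x\in\mathcal U$, all $\eta\in T_x\mathcal M$ with $\|\eta\|_x=1$, and all $t$ such that $R_x(\tau\eta)\in\mathcal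 U$ for all $\tau\in[0,t]$. In (A3) this is understood with $\mathcal U=\mathcal M$. *)

theory Defs
  imports "HOL-Probability.Probability" "HOL-Library.Extended_Nat"
begin

section \<open>Embedded submanifolds of a Euclidean space\<close>

text \<open>
  Everything lives in an ambient Euclidean space (later the \<open>n \<times> r\<close> matrices, whose inner product
  in \<open>real^'r^'n\<close> is the Frobenius one), and manifolds are embedded submanifolds carrying the
  restricted metric. Functions on a manifold are total functions on the ambient space whose values
  off the manifold are never used.
\<close>

primrec Ck_on :: "nat \<Rightarrow> 'a::euclidean_space set \<Rightarrow> ('a \<Rightarrow> 'b::euclidean_space) \<Rightarrow> bool" where
  "Ck_on 0 U f \<longleftrightarrow> continuous_on U f"
| "Ck_on (Suc k) U f \<longleftrightarrow>
     (\<forall>x\<in>U. f differentiable (at x)) \<and> (\<forall>v. Ck_on k U (\<lambda>x. frechet_derivative f (at x) v))"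

text \<open>Class \<open>C\<^sup>k\<close> on an open set, with \<open>k = \<infinity>\<close> for smooth functions.\<close>

definition C_on :: "enat \<Rightarrow> 'a::euclidean_space set \<Rightarrow> ('a \<Rightarrow> 'b::euclidean_space) \<Rightarrow> bool" where
  "C_on k U f \<longleftrightarrow> (\<forall>j. enat j \<le> k \<longrightarrow> Ck_on j U f)"

text \<open>Class \<open>C\<^sup>k\<close> on an arbitrary subset (used for submanifolds): locally the restriction of a
  \<open>C\<^sup>k\<close> function of the ambient space.\<close>

definition C_map_on :: "enat \<Rightarrow> 'a::euclidean_space set \<Rightarrow> ('a \<Rightarrow> 'b::euclidean_space) \<Rightarrow> bool" where
  "C_map_on k A f \<longleftrightarrow>
     (\<forall>x\<in>A. \<exists>U F. open U \<and> x \<in> U \<and> C_on k U F \<and> (\<forall>y\<in>U \<inter> A. F y = f y))"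

definition embedded_submanifold :: "'a::euclidean_space set \<Rightarrow> bool" where
  "embedded_submanifold M \<longleftrightarrow>
     (\<exists>d. \<forall>x\<in>M. \<exists>U V (\<phi> :: 'a \<Rightarrow> 'a) \<psi> S.
        open U \<and> x \<in> U \<and> open V \<and> homeomorphism U V \<phi> \<psi> \<and> C_on \<infinity> U \<phi> \<and> C_on \<infinity> V \<psi> \<and>
        subspace S \<and> dim S = d \<and> \<phi> ` (U \<inter> M) = V \<inter> S)"

definition curve_through ::
    "'a::euclidean_space set \<Rightarrow> 'a \<Rightarrow> 'a \<Rightarrow> (real \<Rightarrow> 'a) \<Rightarrow> bool" where
  "curve_through M x v \<gamma> \<longleftrightarrow>
     (\<exists>e>0. C_on \<infinity> {-e<..<e} \<gamma> \<and> \<gamma> ` {-e<..<e} \<subseteq> M) \<and>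
     \<gamma> 0 = x \<and> (\<gamma> has_vector_derivative v) (at 0)"

definition tangent_space :: "'a::euclidean_space set \<Rightarrow> 'a \<Rightarrow> 'a set" where
  "tangent_space M x = {v. \<exists>\<gamma>. curve_through M x v \<gamma>}"

definition tangent_bundle :: "'a::euclidean_space set \<Rightarrow> ('a \<times> 'a) set" where
  "tangent_bundle M = {(x, \<xi>). x \<in> M \<and> \<xi> \<in> tangent_space M x}"

definition orth_proj :: "'a::euclidean_space set \<Rightarrow> 'a \<Rightarrow> 'a" where
  "orth_proj S z = (THE p. p \<in> S \<and> (\<forall>s\<in>S. orthogonal (z - p) s))"

definition rgrad :: "'a::euclidean_space set \<Rightarrow> ('a \<Rightarrow> real) \<Rightarrow> 'a \<Rightarrow> 'a" where
  "rgrad M f x =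
     (THE g. g \<in> tangent_space M x \<and>
        (\<forall>\<xi> \<gamma>. curve_through M x \<xi> \<gamma> \<longrightarrow>
           ((\<lambda>t. f (\<gamma> t)) has_real_derivative (g \<bullet> \<xi>)) (at 0)))"

text \<open>\<open>R x\<close> maps \<open>T\<^sub>x M\<close> to \<open>M\<close>, smoothly on the tangent bundle, with \<open>R\<^sub>x(0) = x\<close> and
  \<open>D R\<^sub>x(0) = id\<close>.\<close>

definition manifold_retraction ::
    "'a::euclidean_space set \<Rightarrow> ('a \<Rightarrow> 'a \<Rightarrow> 'a) \<Rightarrow> bool" where
  "manifold_retraction M R \<longleftrightarrow>
     C_map_on \<infinity> (tangent_bundle M) (\<lambda>(x, \<xi>). R x \<xi>) \<and>
     (\<forall>x\<in>M. R x ` tangent_space M x \<subseteq> M \<and> R x 0 = x \<and>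
        (R x has_derivative (\<lambda>\<xi>. \<xi>)) (at 0 within tangent_space M x))"

text \<open>Existence of the second derivative of \<open>t \<mapsto> f (R\<^sub>x(t \<eta>))\<close> is part of the condition.\<close>

definition upper_hessian_bounded ::
    "'a::euclidean_space set \<Rightarrow> ('a \<Rightarrow> 'a \<Rightarrow> 'a) \<Rightarrow> 'a set \<Rightarrow> ('a \<Rightarrow> real) \<Rightarrow> real \<Rightarrow> bool" where
  "upper_hessian_bounded M R U f L \<longleftrightarrow>
     L > 0 \<and>
     (\<forall>x\<in>U. \<forall>\<eta>\<in>tangent_space M x. norm \<eta> = 1 \<longrightarrow>
        (\<forall>t\<ge>0. (\<forall>\<tau>\<in>{0..t}. R x (\<tau> *\<^sub>R \<eta>) \<in> U) \<longrightarrow>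
           (\<exists>h' d. (\<forall>\<^sub>F s in nhds t. ((\<lambda>s. f (R x (s *\<^sub>R \<eta>))) has_real_derivative h' s) (at s)) \<and>
                   (h' has_real_derivative d) (at t) \<and> d \<le> L)))"


section \<open>Vectors and matrices\<close>

definition diag_vec :: "real^'m^'m \<Rightarrow> real^'m" where
  "diag_vec A = (\<chi> i. A $ i $ i)"

definition diag_mat :: "real^'m \<Rightarrow> real^'m^'m" where
  "diag_mat v = (\<chi> i j. if i = j then v $ i else 0)"

definition vec_max :: "real^'k \<Rightarrow> real^'k \<Rightarrow> real^'k" where
  "vec_max u v = (\<chi> k. max (u $ k) (v $ k))"

definition vec_powr :: "real^'k \<Rightarrow> real \<Rightarrow> real^'k" where
  "vec_powr v p = (\<chi> k. (v $ k) powr p)"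

definition vec_sqrt :: "real^'k \<Rightarrow> real^'k" where
  "vec_sqrt v = (\<chi> k. sqrt (v $ k))"

definition vec_divide :: "real^'k \<Rightarrow> real^'k \<Rightarrow> real^'k" where
  "vec_divide u v = (\<chi> k. u $ k / v $ k)"

definition const_vec :: "real \<Rightarrow> real^'k" where
  "const_vec c = (\<chi> k. c)"

definition l1_norm :: "real^'k \<Rightarrow> real" where
  "l1_norm v = (\<Sum>k\<in>UNIV. \<bar>v $ k\<bar>)"

text \<open>\<open>\<real>\<^sup>n\<^sup>r\<close> is indexed by pairs (column, row): this is column stacking, and it matches the
  Kronecker product whose first factor is indexed by columns.\<close>

definition vectorize :: "real^'r^'n \<Rightarrow> real^('r::finite \<times> 'n::finite)" where
  "vectorize A = (\<chi> k. A $ (snd k) $ (fst k))"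

definition kronecker :: "real^'r \<Rightarrow> real^'n \<Rightarrow> real^('r::finite \<times> 'n::finite)" where
  "kronecker a b = (\<chi> k. a $ (fst k) * b $ (snd k))"


section \<open>Stochastic gradients and the algorithm\<close>

text \<open>\<open>D\<close> is the law of a random draw \<open>i\<close>, and \<open>gradf i x\<close> is the stochastic gradient at \<open>x\<close> for
  that draw. Joint measurability is what makes the iterates random variables.\<close>

definition stochastic_gradient ::
    "'a::euclidean_space set \<Rightarrow> ('a \<Rightarrow> real) \<Rightarrow> 'i measure \<Rightarrow> ('i \<Rightarrow> 'a \<Rightarrow> 'a) \<Rightarrow> bool" where
  "stochastic_gradient M f D gradf \<longleftrightarrow>
     (\<lambda>(i, x). gradf i x) \<in> borel_measurable (D \<Otimes>\<^sub>M restrict_space borel M) \<and>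
     (\<forall>x\<in>M. (\<forall>i\<in>space D. gradf i x \<in> tangent_space M x) \<and>
        integrable D (\<lambda>i. gradf i x) \<and> (\<integral>i. gradf i x \<partial>D) = rgrad M f x)"

text \<open>\<open>grad t\<close> is the stochastic gradient field used at iteration \<open>t\<close>. Iterations are numbered from
  1; the value \<open>x 0\<close> is unused.\<close>

definition rasa ::
    "(real^'r^'n) set \<Rightarrow> (real^'r^'n \<Rightarrow> real^'r^'n \<Rightarrow> real^'r^'n) \<Rightarrow> (nat \<Rightarrow> real) \<Rightarrow> real \<Rightarrow>
     real^'r^'n \<Rightarrow> (nat \<Rightarrow> real^'r^'n \<Rightarrow> real^'r^'n) \<Rightarrow>
     (nat \<Rightarrow> real^'r^'n) \<Rightarrow> (nat \<Rightarrow> real^'n) \<Rightarrow> (nat \<Rightarrow> real^'n) \<Rightarrow>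
     (nat \<Rightarrow> real^'r) \<Rightarrow> (nat \<Rightarrow> real^'r) \<Rightarrow> bool" where
  "rasa M R \<alpha> \<beta> x\<^sub>1 grad x l lhat r rhat \<longleftrightarrow>
     x 1 = x\<^sub>1 \<and> l 0 = 0 \<and> lhat 0 = 0 \<and> r 0 = 0 \<and> rhat 0 = 0 \<and>
     (\<forall>t\<ge>1. let G = grad t (x t) in
        l t = \<beta> *\<^sub>R l (t - 1) + ((1 - \<beta>) / real CARD('r)) *\<^sub>R diag_vec (G ** transpose G) \<and>
        lhat t = vec_max (lhat (t - 1)) (l t) \<and>
        r t = \<beta> *\<^sub>R r (t - 1) + ((1 - \<beta>) / real CARD('n)) *\<^sub>R diag_vec (transpose G ** G) \<and>
        rhat t = vec_max (rhat (t - 1)) (r t) \<and>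
        x (t + 1) = R (x t)
          (- \<alpha> t *\<^sub>R orth_proj (tangent_space M (x t))
             (diag_mat (vec_powr (lhat t) (- 1/4)) ** G ** diag_mat (vec_powr (rhat t) (- 1/4)))))"

text \<open>Where an entry of \<open>lhat t\<close> or \<open>rhat t\<close> vanishes, the inverse powers and quotients take the
  HOL value 0; the corresponding entries of all stochastic gradients used so far vanish as well.\<close>

end

theory Submission
  imports Defs
begin

text \<open>
  The upper Hessian bound gives a second-order descent inequality along the retraction, and since
  the gradient is tangent, the projection disappears from its linear term. Replacing the scaling
  \<open>A\<^sub>t = \<alpha>\<^sub>t / \<surd>v\<^sub>t\<close> there by \<open>A\<^sub>t\<^sub>-\<^sub>1\<close> costs \<open>H\<^sup>2 \<parallel>A\<^sub>t - A\<^sub>t\<^sub>-\<^sub>1\<parallel>\<^sub>1\<close>, and \<open>A\<^sub>t\<^sub>-\<^sub>1\<close> is independent of draw \<open>t\<close>.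
  As \<open>A\<^sub>t\<^sub>-\<^sub>1\<close> need not be integrable, the average over draw \<open>t\<close> is taken first, with the past
  frozen, and only the resulting inequality between nonnegative quantities is integrated over the
  past; these inequalities telescope. The step \<open>t = 1\<close>, which has no predecessor, is absorbed
  into the constant because the preconditioned gradient is uniformly bounded. Integrating over the
  past needs measurable iterates, hence the continuity of the tangential projection in the base
  point.
\<close>

section \<open>Tangent spaces of embedded submanifolds\<close>

text \<open>Nothing bounds a positive entry of \<open>vhat\<close> away from 0, so its reciprocal
  root has no uniform bound and the expectations in the statement need not be finite. They are
  therefore taken in \<open>ennreal\<close>, which dictates the shape of every inequality: the
  objective enters as \<open>f - m\<close> with a lower bound \<open>m\<close>, and each step reads
  new gap plus gain \<le> old gap plus cost, so that nothing is ever subtracted. Tonelli's theorem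
  on the product of the past with a single draw takes the place of a conditional expectation.
  Entries of \<open>vhat\<close> equal to 0 need no separate treatment: negative powers of 0 and
  quotients by 0 are both 0, so the matrix form and the vectorized form of the step agree, and the
  exchange of scalings is an estimate for arbitrary coefficient vectors.\<close>

lemma Ck_on_subset: "Ck_on k U f \<Longrightarrow> V \<subseteq> U \<Longrightarrow> Ck_on k V f"
  by (induction k arbitrary: f) (auto intro: continuous_on_subset)

text \<open>Openness is essential: a Frechet derivative sees a whole neighbourhood, so agreement on
  \<open>U\<close> passes to derivatives, and the induction repeats this for each directional
  derivative.\<close>

lemma Ck_on_cong:
  assumes "Ck_on k U f" "open U" "\<And>x. x \<in> U \<Longrightarrow> f x = g x"
  shows "Ck_on k U g"
  using assms(1,3)
proof (induction k arbitrary: f g)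
  case 0
  then show ?case using continuous_on_cong[of U U f g] by simp
next
  case (Suc k)
  have diff: "f differentiable (at x)" "g differentiable (at x)"
    and eq: "frechet_derivative f (at x) = frechet_derivative g (at x)" if "x \<in> U" for x
  proof -
    show f: "f differentiable (at x)"
      using Suc.prems(1) that by simp
    then show "g differentiable (at x)"
      unfolding differentiable_def
      using has_derivative_transform_within_open[OF _ \<open>open U\<close> that] Suc.prems(2) by blast
    show "frechet_derivative f (at x) = frechet_derivative g (at x)"
      by (rule frechet_derivative_transform_within_open[OF f \<open>open U\<close> that]) (rule Suc.prems(2))
  qed
  have "Ck_on k U (\<lambda>x. frechet_derivative g (at x) v)" for v
    by (rule Suc.IH[of "\<lambda>x. frechet_derivative f (at x) v"]) (use Suc.prems eq in auto)
  then show ?case using diff by simp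
qed

text \<open>An affine inner map keeps the induction closed: the derivative of the composite in
  direction \<open>h\<close> is a directional derivative of \<open>f\<close> along the same line, in
  the constant direction \<open>h *\<^sub>R s\<close>. This gives smooth chart curves without a
  chain rule of arbitrary order.\<close>

lemma Ck_on_affine_line:
  assumes "Ck_on k V f" "open V"
  shows "Ck_on k {t::real. a + t *\<^sub>R s \<in> V} (\<lambda>t. f (a + t *\<^sub>R s))"
  using assms(1)
proof (induction k arbitrary: f)
  case 0
  then show ?case
    by (auto intro!: continuous_on_compose2[of V f] continuous_intros)
next
  case (Suc k)
  let ?I = "{t::real. a + t *\<^sub>R s \<in> V}"
  have opI: "open ?I"
    using open_vimage[OF assms(2), of "\<lambda>t::real. a + t *\<^sub>R s"]
    by (simp add: vimage_def continuous_intros)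
  have der: "((\<lambda>t. f (a + t *\<^sub>R s)) has_derivative (\<lambda>h. frechet_derivative f (at (a + t *\<^sub>R s)) (h *\<^sub>R s))) (at t)"
    if "t \<in> ?I" for t
  proof -
    have "(f has_derivative frechet_derivative f (at (a + t *\<^sub>R s))) (at (a + t *\<^sub>R s))"
      using Suc.prems that frechet_derivative_works by auto
    moreover have "((\<lambda>t. a + t *\<^sub>R s) has_derivative (\<lambda>h. h *\<^sub>R s)) (at t)"
      by (auto intro!: derivative_eq_intros)
    ultimately show ?thesis
      using diff_chain_at[of "\<lambda>t. a + t *\<^sub>R s" "\<lambda>h. h *\<^sub>R s" t f] by (simp add: o_def)
  qed
  have "Ck_on k ?I (\<lambda>t. frechet_derivative (\<lambda>t. f (a + t *\<^sub>R s)) (at t) h)" for h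
  proof (rule Ck_on_cong[OF _ opI])
    show "Ck_on k ?I (\<lambda>t. frechet_derivative f (at (a + t *\<^sub>R s)) (h *\<^sub>R s))"
      using Suc.IH[of "\<lambda>y. frechet_derivative f (at y) (h *\<^sub>R s)"] Suc.prems by simp
    fix t assume "t \<in> ?I"
    from frechet_derivative_at[OF der[OF this]]
    show "frechet_derivative f (at (a + t *\<^sub>R s)) (h *\<^sub>R s) = frechet_derivative (\<lambda>t. f (a + t *\<^sub>R s)) (at t) h"
      by (rule fun_cong)
  qed
  then show ?case using der by (auto simp: differentiable_def)
qed

lemma C_on_infinity: "C_on \<infinity> U f \<longleftrightarrow> (\<forall>k. Ck_on k U f)"
  by (simp add: C_on_def)

lemma C_on_imp_Ck_on_Suc_0: "C_on k U f \<Longrightarrow> 1 \<le> k \<Longrightarrow> Ck_on (Suc 0) U f"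
  by (metis C_on_def One_nat_def one_enat_def)

lemma C_on_has_derivative:
  assumes "C_on k U f" "1 \<le> k" "x \<in> U"
  shows "(f has_derivative frechet_derivative f (at x)) (at x)"
  using C_on_imp_Ck_on_Suc_0[OF assms(1,2)] assms(3) frechet_derivative_works by auto

lemma C_on_continuous_derivative:
  assumes "C_on k U f" "1 \<le> k"
  shows "continuous_on U (\<lambda>x. frechet_derivative f (at x) v)"
  using C_on_imp_Ck_on_Suc_0[OF assms] by simp

lemma C_map_on_continuous:
  assumes "C_map_on k A f"
  shows "continuous_on A f"
proof (unfold continuous_on_eq_continuous_within, intro ballI)
  fix x assume "x \<in> A"
  with assms obtain U F where UF: "open U" "x \<in> U" "C_on k U F" "\<forall>y\<in>U \<inter> A. F y = f y"
    unfolding C_map_on_def by blast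
  have "Ck_on 0 U F" 
    using UF(3) unfolding C_on_def by (metis enat_0 zero_le)
  then have "continuous (at x within A) F"
    using UF by (simp add: continuous_on_eq_continuous_at continuous_at_imp_continuous_at_within)
  then have "(F \<longlongrightarrow> f x) (at x within A)"
    using UF \<open>x \<in> A\<close> by (simp add: continuous_within)
  moreover have "\<forall>\<^sub>F y in at x within A. F y = f y"
    using UF by (auto simp: eventually_at_topological)
  ultimately show "continuous (at x within A) f"
    unfolding continuous_within by (rule Lim_transform_eventually)
qed

text \<open>In the chart \<open>M\<close> becomes the flat piece \<open>V \<inter> S\<close>, whose
  tangent vectors are those of \<open>S\<close>, and the derivative of the inverse chart carries
  them back. \<open>A\<close> and \<open>B\<close> stay explicit because their continuity in
  \<open>x\<close> is exploited later.\<close>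

lemma tangent_space_chart:
  assumes ch: "open U" "open V" "homeomorphism U V \<phi> \<psi>" "C_on \<infinity> U \<phi>" "C_on \<infinity> V \<psi>"
    "subspace S" "\<phi> ` (U \<inter> M) = V \<inter> S" and x: "x \<in> U \<inter> M"
  defines "A \<equiv> frechet_derivative \<phi> (at x)" and "B \<equiv> frechet_derivative \<psi> (at (\<phi> x))"
  shows "linear A" "linear B" "\<And>v. B (A v) = v" "\<And>v. A (B v) = v" "tangent_space M x = B ` S"
proof -
  have px: "\<phi> x \<in> V" "\<phi> x \<in> S" and inv: "\<And>y. y \<in> U \<Longrightarrow> \<psi> (\<phi> y) = y" "\<And>y. y \<in> V \<Longrightarrow> \<phi> (\<psi> y) = y"
    using x ch(3,7) by (auto simp: homeomorphism_def)
  have dA: "(\<phi> has_derivative A) (at x)" and dB: "(\<psi> has_derivative B) (at (\<phi> x))"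
    unfolding A_def B_def using C_on_has_derivative[OF ch(4)] C_on_has_derivative[OF ch(5)] x px by auto
  show lA: "linear A" and lB: "linear B"
    using dA dB has_derivative_linear by auto
  have "((\<psi> \<circ> \<phi>) has_derivative (B \<circ> A)) (at x)"
    by (rule diff_chain_at[OF dA dB])
  moreover have "((\<psi> \<circ> \<phi>) has_derivative id) (at x)"
    by (rule has_derivative_transform_within_open[OF has_derivative_id[unfolded id_def[symmetric]] ch(1)])
      (use x inv in auto)
  ultimately have "B \<circ> A = id"
    using has_derivative_unique by blast
  then show BA: "\<And>v. B (A v) = v"
    by (metis comp_apply id_apply)
  have "\<psi> (\<phi> x) = x" using inv x by auto
  then have "((\<phi> \<circ> \<psi>) has_derivative (A \<circ> B)) (at (\<phi> x))"
    using diff_chain_at[OF dB] dA by simp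
  moreover have "((\<phi> \<circ> \<psi>) has_derivative id) (at (\<phi> x))"
    by (rule has_derivative_transform_within_open[OF has_derivative_id[unfolded id_def[symmetric]] ch(2)])
      (use px inv in auto)
  ultimately have "A \<circ> B = id"
    using has_derivative_unique by blast
  then show AB: "\<And>v. A (B v) = v"
    by (metis comp_apply id_apply)
  show "tangent_space M x = B ` S"
  proof (intro equalityI subsetI)
    fix v assume "v \<in> tangent_space M x"
    then obtain \<gamma> e where \<gamma>: "e > 0" "\<gamma> ` {-e<..<e} \<subseteq> M" "\<gamma> 0 = x" "(\<gamma> has_vector_derivative v) (at 0)"
      unfolding tangent_space_def curve_through_def by auto
    have "((\<phi> \<circ> \<gamma>) has_vector_derivative A v) (at 0)"
      using vector_derivative_diff_chain_within[OF \<gamma>(4), of \<phi> A] dA \<gamma>(3)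
      by (simp add: has_derivative_at_withinI)
    then have "((\<lambda>t. norm (\<phi> (\<gamma> t) - \<phi> x - t *\<^sub>R A v) / norm t) \<longlongrightarrow> 0) (at 0)"
      using \<gamma>(3) by (simp add: has_vector_derivative_def has_derivative_at)
    moreover have "norm (\<phi> (\<gamma> t) - \<phi> x - t *\<^sub>R A v) / norm t = norm ((\<phi> (\<gamma> t) - \<phi> x) /\<^sub>R t - A v)" if "t \<noteq> 0" for t
    proof -
      have "(\<phi> (\<gamma> t) - \<phi> x) /\<^sub>R t - A v = (\<phi> (\<gamma> t) - \<phi> x - t *\<^sub>R A v) /\<^sub>R t"
        using that by (simp add: scaleR_diff_right)
      then show ?thesis by (simp add: divide_inverse mult.commute)
    qed
    ultimately have "((\<lambda>t. norm ((\<phi> (\<gamma> t) - \<phi> x) /\<^sub>R t - A v)) \<longlongrightarrow> 0) (at 0)"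
      by (rule Lim_transform_eventually[OF _ eventually_mono[OF eventually_neq_at_within]])
    \<comment> \<open>Near 0 these difference quotients lie in the closed set \<open>S\<close>,
      hence so does their limit \<open>A v\<close>.\<close>
    then have lim: "((\<lambda>t. (\<phi> (\<gamma> t) - \<phi> x) /\<^sub>R t) \<longlongrightarrow> A v) (at 0)"
      by (simp add: tendsto_norm_zero_iff LIM_zero_iff)
    have "continuous (at 0) \<gamma>"
      using \<gamma>(4) has_vector_derivative_continuous by blast
    then have "\<forall>\<^sub>F t in at 0. \<gamma> t \<in> U"
      using topological_tendstoD[of \<gamma> "\<gamma> 0" "at 0" U] \<gamma>(3) x ch(1) by (simp add: continuous_at)
    moreover have "\<forall>\<^sub>F t in at 0. t \<in> {-e<..<e}"
      by (rule eventually_at_in_open') (use \<gamma>(1) in auto)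
    ultimately have "\<forall>\<^sub>F t in at 0. (\<phi> (\<gamma> t) - \<phi> x) /\<^sub>R t \<in> S"
    proof eventually_elim
      case (elim t)
      then have "\<phi> (\<gamma> t) \<in> S" using \<gamma>(2) ch(7) by blast
      then show ?case using px(2) ch(6) by (simp add: subspace_diff subspace_scale)
    qed
    then have "A v \<in> S"
      using Lim_in_closed_set[OF closed_subspace[OF ch(6)] _ _ lim] by simp
    then show "v \<in> B ` S" using BA by (metis imageI)
  next
    fix v assume "v \<in> B ` S"
    then obtain s where s: "s \<in> S" "v = B s" by auto
    \<comment> \<open>The witness is the straight line through \<open>\<phi> x\<close> in direction
      \<open>s\<close>, pulled back by \<open>\<psi>\<close>; it stays in \<open>M\<close> as long
      as the line stays in \<open>V\<close>.\<close>
    let ?\<gamma> = "\<lambda>t. \<psi> (\<phi> x + t *\<^sub>R s)" and ?I = "{t::real. \<phi> x + t *\<^sub>R s \<in> V}"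
    have "open ?I"
      using open_vimage[OF ch(2), of "\<lambda>t::real. \<phi> x + t *\<^sub>R s"]
      by (simp add: vimage_def continuous_intros)
    moreover have "0 \<in> ?I" using px by simp
    ultimately obtain e where e: "e > 0" "ball 0 e \<subseteq> ?I"
      by (meson open_contains_ball)
    then have I: "{-e<..<e} \<subseteq> ?I"
      by (auto simp: ball_eq_greaterThanLessThan)
    have "C_on \<infinity> {-e<..<e} ?\<gamma>"
      unfolding C_on_infinity
    proof
      fix k
      have "Ck_on k V \<psi>" using ch(5) by (simp add: C_on_infinity)
      then show "Ck_on k {-e<..<e} ?\<gamma>"
        by (intro Ck_on_subset[OF Ck_on_affine_line I] ch(2))
    qed
    moreover have "?\<gamma> ` {-e<..<e} \<subseteq> M"
    proof (intro image_subsetI)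
      fix t assume "t \<in> {-e<..<e}"
      then have "\<phi> x + t *\<^sub>R s \<in> V \<inter> S"
        using I px s ch(6) subspace_add[OF ch(6)] subspace_scale[OF ch(6)] by auto
      then obtain y where "y \<in> U \<inter> M" "\<phi> x + t *\<^sub>R s = \<phi> y"
        using ch(7) by (metis imageE)
      then show "?\<gamma> t \<in> M" using inv by auto
    qed
    moreover have "(?\<gamma> has_vector_derivative v) (at 0)"
    proof -
      have "((\<lambda>t. \<phi> x + t *\<^sub>R s) has_vector_derivative s) (at 0)"
        by (auto intro!: derivative_eq_intros)
      then have "(\<psi> \<circ> (\<lambda>t. \<phi> x + t *\<^sub>R s) has_vector_derivative B s) (at 0)"
        using vector_derivative_diff_chain_within[of "\<lambda>t. \<phi> x + t *\<^sub>R s" s 0 UNIV \<psi> B] dB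
        by (simp add: has_derivative_at_withinI)
      then show ?thesis by (simp add: s(2) o_def)
    qed
    ultimately have "curve_through M x v ?\<gamma>"
      unfolding curve_through_def using e(1) inv x by auto
    then show "v \<in> tangent_space M x" unfolding tangent_space_def by blast
  qed
qed

text \<open>A moving frame: \<open>B y\<close> maps one fixed subspace \<open>S\<close> onto every
  nearby tangent space and \<open>A y\<close> undoes it. Continuity is recorded for each fixed
  vector, which suffices for linear maps in finite dimension.\<close>

lemma tangent_space_local_frame:
  fixes M :: "'a::euclidean_space set"
  assumes "embedded_submanifold M" "x \<in> M"
  obtains U S :: "'a set" and A B :: "'a \<Rightarrow> 'a \<Rightarrow> 'a" where "open U" "x \<in> U" "subspace S"
    "\<And>y. y \<in> U \<inter> M \<Longrightarrow> linear (A y)" "\<And>y. y \<in> U \<inter> M \<Longrightarrow> linear (B y)"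
    "\<And>y v. y \<in> U \<inter> M \<Longrightarrow> B y (A y v) = v" "\<And>y v. y \<in> U \<inter> M \<Longrightarrow> A y (B y v) = v"
    "\<And>y. y \<in> U \<inter> M \<Longrightarrow> tangent_space M y = B y ` S"
    "\<And>v. continuous_on (U \<inter> M) (\<lambda>y. A y v)" "\<And>v. continuous_on (U \<inter> M) (\<lambda>y. B y v)"
proof -
  obtain U V S and \<phi> \<psi> :: "'a \<Rightarrow> 'a"
    where ch: "open U" "open V" "homeomorphism U V \<phi> \<psi>" "C_on \<infinity> U \<phi>" "C_on \<infinity> V \<psi>"
      "subspace S" "\<phi> ` (U \<inter> M) = V \<inter> S" and x: "x \<in> U"
    using assms unfolding embedded_submanifold_def by metis
  note T = tangent_space_chart[OF ch]
  have "continuous_on (U \<inter> M) (\<lambda>y. frechet_derivative \<phi> (at y) v)" for v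
    using continuous_on_subset[OF C_on_continuous_derivative[OF ch(4)]] by simp
  moreover have "continuous_on (U \<inter> M) (\<lambda>y. frechet_derivative \<psi> (at (\<phi> y)) v)" for v
    using continuous_on_compose2[OF C_on_continuous_derivative[OF ch(5)], of "U \<inter> M" \<phi> v] ch(3,7)
    by (auto simp: homeomorphism_def intro: continuous_on_subset)
  ultimately show thesis
    by (intro that[OF ch(1) x ch(6), of "\<lambda>y. frechet_derivative \<phi> (at y)" "\<lambda>y. frechet_derivative \<psi> (at (\<phi> y))"])
      (use T in auto)
qed

lemma subspace_tangent_space:
  assumes "embedded_submanifold M" "x \<in> M"
  shows "subspace (tangent_space M x)"
  by (rule tangent_space_local_frame[OF assms]) (use assms(2) in \<open>simp add: linear_subspace_image\<close>)


section \<open>Orthogonal projection and its continuity in the base point\<close>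

lemma orth_proj_eqI:
  assumes "subspace S" "p \<in> S" "\<And>s. s \<in> S \<Longrightarrow> (z - p) \<bullet> s = 0"
  shows "orth_proj S z = p"
  unfolding orth_proj_def orthogonal_def
proof (rule the_equality)
  fix q assume q: "q \<in> S \<and> (\<forall>s\<in>S. (z - q) \<bullet> s = 0)"
  then have "p - q \<in> S" using assms by (simp add: subspace_diff)
  then have "(z - q) \<bullet> (p - q) - (z - p) \<bullet> (p - q) = 0" using q assms(3) by simp
  then have "(p - q) \<bullet> (p - q) = 0" by (simp add: inner_diff_left)
  then show "q = p" by simp
qed (use assms in auto)

lemma orth_proj_in: "subspace S \<Longrightarrow> orth_proj S z \<in> S"
  and orth_proj_orthogonal: "subspace S \<Longrightarrow> s \<in> S \<Longrightarrow> (z - orth_proj S z) \<bullet> s = 0"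
proof -
  assume S: "subspace S"
  then have span: "span S = S" by simp
  obtain p q where pq: "p \<in> S" "\<And>w. w \<in> S \<Longrightarrow> orthogonal q w" "z = p + q"
    using orthogonal_subspace_decomp_exists[of S z] unfolding span by blast
  then have p: "p \<in> S" "\<And>s. s \<in> S \<Longrightarrow> (z - p) \<bullet> s = 0"
    using pq by (auto simp: orthogonal_def)
  have eq: "orth_proj S z = p" by (rule orth_proj_eqI[OF S p])
  show "orth_proj S z \<in> S" using eq p by simp
  show "(z - orth_proj S z) \<bullet> s = 0" if "s \<in> S" using eq p that by simp
qed

lemma inner_orth_proj: "subspace S \<Longrightarrow> s \<in> S \<Longrightarrow> s \<bullet> orth_proj S z = s \<bullet> z"
  using orth_proj_orthogonal[of S s z] by (simp add: inner_diff_left inner_commute[of s])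

lemma norm_orth_proj_le:
  assumes "subspace S"
  shows "norm (orth_proj S z) \<le> norm z"
proof -
  have "(norm (orth_proj S z))\<^sup>2 = orth_proj S z \<bullet> z"
    using inner_orth_proj[OF assms orth_proj_in[OF assms, of z], of z]
    by (simp add: power2_norm_eq_inner)
  also have "\<dots> \<le> norm (orth_proj S z) * norm z"
    by (rule norm_cauchy_schwarz)
  finally show ?thesis
    by (cases "norm (orth_proj S z) = 0") (auto simp: power2_eq_square)
qed

text \<open>Expanding the argument in the basis reduces moving arguments to finitely many fixed
  vectors.\<close>

lemma tendsto_linear_field:
  fixes A :: "'i \<Rightarrow> 'a::euclidean_space \<Rightarrow> 'b::real_normed_vector"
  assumes "\<forall>\<^sub>F n in F. linear (A n)" "linear A0" "\<And>v. ((\<lambda>n. A n v) \<longlongrightarrow> A0 v) F" "(w \<longlongrightarrow> w0) F"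
  shows "((\<lambda>n. A n (w n)) \<longlongrightarrow> A0 w0) F"
proof -
  have expand: "(\<Sum>b\<in>Basis. (w \<bullet> b) *\<^sub>R L b) = L w" if "linear L" for L :: "'a \<Rightarrow> 'b" and w
  proof -
    have "L w = L (\<Sum>b\<in>Basis. (w \<bullet> b) *\<^sub>R b)" by (simp add: euclidean_representation)
    also have "\<dots> = (\<Sum>b\<in>Basis. (w \<bullet> b) *\<^sub>R L b)" 
      using that by (simp add: linear_sum linear_scale)
    finally show ?thesis by simp
  qed
  have "((\<lambda>n. \<Sum>b\<in>Basis. (w n \<bullet> b) *\<^sub>R A n b) \<longlongrightarrow> (\<Sum>b\<in>Basis. (w0 \<bullet> b) *\<^sub>R A0 b)) F"
    by (intro tendsto_intros assms)
  moreover have "\<forall>\<^sub>F n in F. (\<Sum>b\<in>Basis. (w n \<bullet> b) *\<^sub>R A n b) = A n (w n)"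
    using assms(1) by eventually_elim (rule expand)
  ultimately show ?thesis
    unfolding expand[OF assms(2)] by (rule Lim_transform_eventually)
qed

text \<open>Otherwise a subsequence stays \<open>e\<close> away from \<open>p0\<close>; by
  compactness it has a convergent further subsequence, whose limit would have to be
  \<open>p0\<close>.\<close>

lemma bounded_tendsto_if_cluster_points:
  fixes p :: "nat \<Rightarrow> 'a::euclidean_space"
  assumes "bounded (range p)"
    and cluster: "\<And>s q. strict_mono s \<Longrightarrow> (p \<circ> s) \<longlonglongrightarrow> q \<Longrightarrow> q = p0"
  shows "p \<longlonglongrightarrow> p0"
proof (rule ccontr)
  assume "\<not> p \<longlonglongrightarrow> p0"
  then obtain e where e: "e > 0" "\<exists>\<^sub>F n in sequentially. \<not> dist (p n) p0 < e"
    unfolding tendsto_iff frequently_def by auto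
  then have "infinite {n. \<not> dist (p n) p0 < e}"
    by (simp add: frequently_cofinite[symmetric] cofinite_eq_sequentially)
  then obtain s :: "nat \<Rightarrow> nat" where s: "strict_mono s" "\<And>n. \<not> dist (p (s n)) p0 < e"
    using infinite_enumerate by blast
  have "bounded (range (p \<circ> s))"
    using assms(1) by (rule bounded_subset) auto
  then obtain q u where u: "strict_mono u" "((p \<circ> s) \<circ> u) \<longlonglongrightarrow> q"
    using bounded_imp_convergent_subsequence by blast
  then have "q = p0"
    using cluster[of "s \<circ> u" q] s(1) by (simp add: strict_mono_o o_assoc)
  then have "\<forall>\<^sub>F n in sequentially. dist (p (s (u n))) p0 < e"
    using u(2) e(1) by (auto simp: tendsto_iff)
  then show False using s(2) by simp
qed


text \<open>The projection is characterised by membership in the tangent space and orthogonality of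
  the remainder. Both conditions pass to limits through the frame, so every cluster point is the
  projection at the limit; boundedness comes from nonexpansiveness.\<close>

lemma continuous_on_orth_proj_tangent_space:
  fixes M :: "'a::euclidean_space set"
  assumes M: "embedded_submanifold M"
  shows "continuous_on (M \<times> UNIV) (\<lambda>(x, z). orth_proj (tangent_space M x) z)"
proof (rule continuous_on_sequentiallyI)
  fix u :: "nat \<Rightarrow> 'a \<times> 'a" and a
  assume u: "\<forall>n. u n \<in> M \<times> UNIV" and a: "a \<in> M \<times> UNIV" and lim: "u \<longlonglongrightarrow> a"
  let ?T = "tangent_space M"
  let ?p = "\<lambda>n. orth_proj (?T (fst (u n))) (snd (u n))"
  have sub: "subspace (?T (fst (u n)))" for n
    using subspace_tangent_space[OF M] u by (auto simp: mem_Times_iff)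
  have ux: "fst (u n) \<in> M" for n using u by (simp add: mem_Times_iff)
  obtain x z where [simp]: "a = (x, z)" by fastforce
  have xM: "x \<in> M" using a by simp
  have limx: "(\<lambda>n. fst (u n)) \<longlonglongrightarrow> x" and limz: "(\<lambda>n. snd (u n)) \<longlonglongrightarrow> z"
    using tendsto_fst[OF lim] tendsto_snd[OF lim] by simp_all
  have lim_proj: "?p \<longlonglongrightarrow> orth_proj (?T x) z"
  proof (rule tangent_space_local_frame[OF M xM])
    fix U S :: "'a set" and A B :: "'a \<Rightarrow> 'a \<Rightarrow> 'a"
    assume fr: "open U" "x \<in> U" "subspace S"
      "\<And>y. y \<in> U \<inter> M \<Longrightarrow> linear (A y)" "\<And>y. y \<in> U \<inter> M \<Longrightarrow> linear (B y)"
      "\<And>y v. y \<in> U \<inter> M \<Longrightarrow> B y (A y v) = v" "\<And>y v. y \<in> U \<inter> M \<Longrightarrow> A y (B y v) = v"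
      "\<And>y. y \<in> U \<inter> M \<Longrightarrow> ?T y = B y ` S"
      "\<And>v. continuous_on (U \<inter> M) (\<lambda>y. A y v)" "\<And>v. continuous_on (U \<inter> M) (\<lambda>y. B y v)"
    have x: "x \<in> U \<inter> M" using fr(2) xM by simp
    have evU: "\<forall>\<^sub>F n in sequentially. fst (u n) \<in> U \<inter> M"
      using topological_tendstoD[OF limx fr(1,2)] ux by simp
    have limA: "(\<lambda>n. A (fst (u n)) v) \<longlonglongrightarrow> A x v" and limB: "(\<lambda>n. B (fst (u n)) v) \<longlonglongrightarrow> B x v" for v
      using continuous_on_tendsto_compose[OF fr(9) limx x evU] continuous_on_tendsto_compose[OF fr(10) limx x evU]
      by this
    have "bounded (range (\<lambda>n. snd (u n)))"
      using limz by (rule convergent_imp_bounded)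
    then obtain K where K: "\<forall>n. norm (snd (u n)) \<le> K"
      unfolding bounded_iff by auto
    have "norm (?p n) \<le> K" for n
      by (rule order_trans[OF norm_orth_proj_le[OF sub] K[rule_format]])
    then have "bounded (range ?p)"
      unfolding bounded_iff by blast
    then show "?p \<longlonglongrightarrow> orth_proj (?T x) z"
    proof (rule bounded_tendsto_if_cluster_points)
      fix s :: "nat \<Rightarrow> nat" and q assume s: "strict_mono s" and q: "(?p \<circ> s) \<longlonglongrightarrow> q"
      have evs: "\<forall>\<^sub>F n in sequentially. fst (u (s n)) \<in> U \<inter> M"
        by (rule eventually_compose_filterlim[OF evU filterlim_subseq[OF s]])
      have linA: "\<forall>\<^sub>F n in sequentially. linear (A (fst (u (s n))))"
        using evs by eventually_elim (rule fr(4))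
      have limAs: "(\<lambda>n. A (fst (u (s n))) v) \<longlonglongrightarrow> A x v" and limBs: "(\<lambda>n. B (fst (u (s n))) v) \<longlonglongrightarrow> B x v" for v
        using LIMSEQ_subseq_LIMSEQ[OF limA s] LIMSEQ_subseq_LIMSEQ[OF limB s] by (simp_all add: o_def)
      \<comment> \<open>The coordinates \<open>A\<close> move the varying tangent spaces into the
        fixed closed subspace \<open>S\<close>, where the limit can be taken.\<close>
      have limAp: "(\<lambda>n. A (fst (u (s n))) (?p (s n))) \<longlonglongrightarrow> A x q"
        by (rule tendsto_linear_field[OF linA fr(4)[OF x] limAs]) (use q in \<open>simp add: o_def\<close>)
      have "\<forall>\<^sub>F n in sequentially. A (fst (u (s n))) (?p (s n)) \<in> S"
        using evs
      proof eventually_elim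
        case (elim n)
        then have "?p (s n) \<in> B (fst (u (s n))) ` S"
          using orth_proj_in[OF sub, of "s n" "snd (u (s n))"] fr(8)[OF elim] by simp
        then obtain w where "w \<in> S" "?p (s n) = B (fst (u (s n))) w" by blast
        then show ?case using fr(7)[OF elim] by simp
      qed
      then have "A x q \<in> S"
        using Lim_in_closed_set[OF closed_subspace[OF fr(3)] _ _ limAp] by simp
      then have "B x (A x q) \<in> ?T x" unfolding fr(8)[OF x] by (rule imageI)
      then have qT: "q \<in> ?T x" by (simp only: fr(6)[OF x])
      have "(z - q) \<bullet> v = 0" if v: "v \<in> ?T x" for v
      proof -
        \<comment> \<open>A tangent vector at the limit is approximated by the tangent vectors with
          the same coordinate \<open>w\<close> at the nearby points, where orthogonality is
          known.\<close>
        obtain w where w: "w \<in> S" "v = B x w" using v unfolding fr(8)[OF x] by blast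
        have "(\<lambda>n. (snd (u (s n)) - ?p (s n)) \<bullet> B (fst (u (s n))) w) \<longlonglongrightarrow> (z - q) \<bullet> v"
          unfolding w(2) using LIMSEQ_subseq_LIMSEQ[OF limz s] q 
          by (intro tendsto_intros limBs) (simp_all add: o_def)
        moreover have "\<forall>\<^sub>F n in sequentially. (snd (u (s n)) - ?p (s n)) \<bullet> B (fst (u (s n))) w = 0"
          using evs
        proof eventually_elim
          case (elim n)
          then have "B (fst (u (s n))) w \<in> ?T (fst (u (s n)))"
            using fr(8)[OF elim] w(1) by simp
          then show ?case by (rule orth_proj_orthogonal[OF sub])
        qed
        ultimately have "(\<lambda>n. 0::real) \<longlonglongrightarrow> (z - q) \<bullet> v"
          by (rule Lim_transform_eventually)
        then show ?thesis by (simp add: LIMSEQ_const_iff)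
      qed
      then show "q = orth_proj (?T x) z"
        using orth_proj_eqI[OF subspace_tangent_space[OF M xM] qT] by simp
    qed
  qed
  then show "(\<lambda>n. (\<lambda>(x, z). orth_proj (?T x) z) (u n)) \<longlonglongrightarrow> (\<lambda>(x, z). orth_proj (?T x) z) a"
    by (simp add: case_prod_beta)
qed

section \<open>Riemannian gradients and descent\<close>

text \<open>The gradient exists as the tangential projection of the ambient gradient of a local
  extension, and it is unique because the difference of two candidates is itself a tangent vector to
  test with. The second claim asks of the curve only a derivative at 0 and membership in
  \<open>M\<close> nearby, so it applies directly to retraction rays.\<close>

lemma rgrad_properties:
  assumes M: "embedded_submanifold M" and f: "C_map_on 1 M f" and x: "x \<in> M"
  shows rgrad_in: "rgrad M f x \<in> tangent_space M x"
    and rgrad_along_curve: "\<xi> \<in> tangent_space M x \<Longrightarrow> c 0 = x \<Longrightarrow> (c has_vector_derivative \<xi>) (at 0) \<Longrightarrow>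
           \<forall>\<^sub>F t in at 0. c t \<in> M \<Longrightarrow> ((\<lambda>t. f (c t)) has_real_derivative (rgrad M f x \<bullet> \<xi>)) (at 0)"
proof -
  let ?T = "tangent_space M x"
  have T: "subspace ?T" by (rule subspace_tangent_space[OF M x])
  obtain U F where UF: "open U" "x \<in> U" "C_on 1 U F" "\<forall>y\<in>U \<inter> M. F y = f y"
    using f x unfolding C_map_on_def by meson
  define F' where "F' = frechet_derivative F (at x)"
  have dF: "(F has_derivative F') (at x)"
    unfolding F'_def by (rule C_on_has_derivative[OF UF(3) _ UF(2)]) simp
  \<comment> \<open>The Riesz representative of the ambient derivative.\<close>
  define a where "a = (\<Sum>b\<in>Basis. F' b *\<^sub>R b)"
  have F'a: "F' v = a \<bullet> v" for v
  proof -
    have "F' v = F' (\<Sum>b\<in>Basis. (v \<bullet> b) *\<^sub>R b)" by (simp add: euclidean_representation)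
    also have "\<dots> = (\<Sum>b\<in>Basis. (v \<bullet> b) * F' b)"
      using has_derivative_linear[OF dF] by (simp add: linear_sum linear_scale)
    also have "\<dots> = a \<bullet> v"
      by (simp add: a_def inner_sum_left mult.commute inner_commute[of v])
    finally show ?thesis .
  qed
  define g where "g = orth_proj ?T a"
  have gT: "g \<in> ?T" unfolding g_def by (rule orth_proj_in[OF T])
  have F'g: "F' v = g \<bullet> v" if "v \<in> ?T" for v
    using inner_orth_proj[OF T that, of a] by (simp add: F'a g_def inner_commute)
  have curve: "((\<lambda>t. f (c t)) has_real_derivative (g \<bullet> \<xi>)) (at 0)"
    if \<xi>: "\<xi> \<in> ?T" and c: "c 0 = x" "(c has_vector_derivative \<xi>) (at 0)" and cM: "\<forall>\<^sub>F t in at 0. c t \<in> M" for \<xi> c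
  proof -
    have "(F \<circ> c has_vector_derivative F' \<xi>) (at 0)"
      using vector_derivative_diff_chain_within[OF c(2), of F F'] dF c(1)
      by (simp add: has_derivative_at_withinI)
    then have d: "((\<lambda>t. F (c t)) has_real_derivative (g \<bullet> \<xi>)) (at 0)"
      by (simp add: has_real_derivative_iff_has_vector_derivative o_def F'g[OF \<xi>])
    have "continuous (at 0) c"
      using c(2) by (rule has_vector_derivative_continuous)
    then have "\<forall>\<^sub>F t in at 0. c t \<in> U"
      using topological_tendstoD[of c "c 0" "at 0" U] c(1) UF(1,2) by (simp add: continuous_at)
    with cM have "\<forall>\<^sub>F t in at 0. F (c t) = f (c t)"
      by eventually_elim (simp add: UF(4))
    moreover have "F (c 0) = f (c 0)"
      using UF(2,4) c(1) x by simp
    ultimately have "\<forall>\<^sub>F t in nhds 0. F (c t) = f (c t)"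
      by (simp add: eventually_nhds_conv_at)
    then show ?thesis
      using DERIV_cong_ev[of 0 0 "\<lambda>t. F (c t)" "\<lambda>t. f (c t)" "g \<bullet> \<xi>"] d by simp
  qed
  have curve_through: "((\<lambda>t. f (\<gamma> t)) has_real_derivative (g \<bullet> \<xi>)) (at 0)"
    if c: "curve_through M x \<xi> \<gamma>" for \<xi> \<gamma>
  proof -
    obtain e where e: "e > 0" "\<gamma> ` {-e<..<e} \<subseteq> M" "\<gamma> 0 = x" "(\<gamma> has_vector_derivative \<xi>) (at 0)"
      using c unfolding curve_through_def by auto
    have "\<forall>\<^sub>F t in at 0. t \<in> {-e<..<e}"
      by (rule eventually_at_in_open') (use e(1) in auto)
    then have "\<forall>\<^sub>F t in at 0. \<gamma> t \<in> M"
      by eventually_elim (use e(2) in auto)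
    moreover have "\<xi> \<in> ?T" using c unfolding tangent_space_def by auto
    ultimately show ?thesis using curve e(3,4) by simp
  qed
  have eq: "rgrad M f x = g"
    unfolding rgrad_def
  proof (rule the_equality)
    fix h assume h: "h \<in> ?T \<and> (\<forall>\<xi> \<gamma>. curve_through M x \<xi> \<gamma> \<longrightarrow>
           ((\<lambda>t. f (\<gamma> t)) has_real_derivative (h \<bullet> \<xi>)) (at 0))"
    then have "h - g \<in> ?T" using gT T by (simp add: subspace_diff)
    then obtain \<gamma> where "curve_through M x (h - g) \<gamma>"
      unfolding tangent_space_def by blast
    then have "h \<bullet> (h - g) = g \<bullet> (h - g)"
      using DERIV_unique[OF h[THEN conjunct2, rule_format] curve_through] by auto
    then have "(h - g) \<bullet> (h - g) = 0" by (simp add: inner_diff_left)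
    then show "h = g" by simp
  qed (use gT curve_through in auto)
  show "rgrad M f x \<in> ?T" using eq gT by simp
  show "((\<lambda>t. f (c t)) has_real_derivative (rgrad M f x \<bullet> \<xi>)) (at 0)"
    if "\<xi> \<in> ?T" "c 0 = x" "(c has_vector_derivative \<xi>) (at 0)" "\<forall>\<^sub>F t in at 0. c t \<in> M"
    using curve[OF that] eq by simp
qed

text \<open>Monotonicity is used twice, for \<open>h t - L * t\<close> and then for
  \<open>\<phi>\<close> minus its quadratic majorant. This handles a second derivative that merely
  exists at each point.\<close>

lemma second_order_upper_bound:
  fixes \<phi> h :: "real \<Rightarrow> real"
  assumes T: "0 \<le> T"
    and h: "\<And>t. 0 \<le> t \<Longrightarrow> t \<le> T \<Longrightarrow> (\<phi> has_real_derivative h t) (at t)"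
    and d: "\<And>t. 0 \<le> t \<Longrightarrow> t \<le> T \<Longrightarrow> \<exists>d\<le>L. (h has_real_derivative d) (at t)"
  shows "\<phi> T \<le> \<phi> 0 + T * h 0 + L / 2 * T\<^sup>2"
proof -
  have h_le: "h t \<le> h 0 + L * t" if t: "0 \<le> t" "t \<le> T" for t
  proof -
    have "h t - L * t \<le> h 0 - L * 0"
    proof (rule DERIV_nonpos_imp_nonincreasing[OF t(1)])
      fix s assume "0 \<le> s" "s \<le> t"
      then obtain d where "d \<le> L" "(h has_real_derivative d) (at s)"
        using assms(3)[of s] t by auto
      then show "\<exists>y. ((\<lambda>t. h t - L * t) has_real_derivative y) (at s) \<and> y \<le> 0"
        by (intro exI[of _ "d - L"]) (auto intro!: derivative_eq_intros)
    qed
    then show ?thesis by simp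
  qed
  have "\<phi> T - h 0 * T - L / 2 * T\<^sup>2 \<le> \<phi> 0 - h 0 * 0 - L / 2 * 0\<^sup>2"
  proof (rule DERIV_nonpos_imp_nonincreasing[OF T])
    fix s assume s: "0 \<le> s" "s \<le> T"
    show "\<exists>y. ((\<lambda>t. \<phi> t - h 0 * t - L / 2 * t\<^sup>2) has_real_derivative y) (at s) \<and> y \<le> 0"
      by (intro exI[of _ "h s - h 0 - L * s"])
        (use h[OF s] h_le[OF s] in \<open>auto intro!: derivative_eq_intros\<close>)
  qed
  then show ?thesis by (simp add: mult.commute)
qed

text \<open>Along the ray in the unit direction \<open>\<eta>\<close>, for which the Hessian bound
  is stated, the claim is one-dimensional with end point \<open>norm \<xi>\<close>.\<close>

lemma retraction_descent:
  assumes M: "embedded_submanifold M" and f: "C_map_on 1 M f" and R: "manifold_retraction M R"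
    and H: "upper_hessian_bounded M R M f L" and x: "x \<in> M" and \<xi>: "\<xi> \<in> tangent_space M x"
  shows "f (R x \<xi>) \<le> f x + rgrad M f x \<bullet> \<xi> + L / 2 * (norm \<xi>)\<^sup>2"
proof (cases "\<xi> = 0")
  case True
  then show ?thesis using R x by (simp add: manifold_retraction_def)
next
  case False
  let ?T = "tangent_space M x"
  have T: "subspace ?T" by (rule subspace_tangent_space[OF M x])
  define \<eta> where "\<eta> = \<xi> /\<^sub>R norm \<xi>"
  have \<eta>: "\<eta> \<in> ?T" "norm \<eta> = 1" "\<xi> = norm \<xi> *\<^sub>R \<eta>"
    using False \<xi> T by (auto simp: \<eta>_def subspace_scale)
  have ray: "\<tau> *\<^sub>R \<eta> \<in> ?T" for \<tau> using \<eta>(1) T by (simp add: subspace_scale)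
  have RM: "R x (\<tau> *\<^sub>R \<eta>) \<in> M" for \<tau>
    using R x ray unfolding manifold_retraction_def by blast
  have R0: "R x 0 = x" and dR: "(R x has_derivative (\<lambda>\<xi>. \<xi>)) (at 0 within ?T)"
    using R x unfolding manifold_retraction_def by blast+
  define \<phi> where "\<phi> = (\<lambda>s. f (R x (s *\<^sub>R \<eta>)))"
  have ex: "\<exists>h' d. (\<forall>\<^sub>F s in nhds t. (\<phi> has_real_derivative h' s) (at s)) \<and>
                   (h' has_real_derivative d) (at t) \<and> d \<le> L" if "t \<ge> 0" for t
  proof -
    have "\<forall>t\<ge>0. (\<forall>\<tau>\<in>{0..t}. R x (\<tau> *\<^sub>R \<eta>) \<in> M) \<longrightarrow>
           (\<exists>h' d. (\<forall>\<^sub>F s in nhds t. (\<phi> has_real_derivative h' s) (at s)) \<and>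
                   (h' has_real_derivative d) (at t) \<and> d \<le> L)"
      using H x \<eta>(1,2) unfolding upper_hessian_bounded_def \<phi>_def by simp
    then show ?thesis using that RM by simp
  qed
  \<comment> \<open>The Hessian bound supplies a possibly different \<open>h'\<close> around each
    \<open>t\<close>. All of them agree locally with \<open>deriv \<phi>\<close>, which serves as a
    single first derivative on the whole ray.\<close>
  have der: "(\<phi> has_real_derivative deriv \<phi> t) (at t)"
    and der2: "\<exists>d\<le>L. (deriv \<phi> has_real_derivative d) (at t)" if t: "t \<ge> 0" for t
  proof -
    obtain h' d where h': "\<forall>\<^sub>F s in nhds t. (\<phi> has_real_derivative h' s) (at s)"
      "(h' has_real_derivative d) (at t)" "d \<le> L"
      using ex[OF t] by blast
    have "(\<phi> has_real_derivative h' t) (at t)" using h'(1) by (rule eventually_nhds_x_imp_x)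
    then show "(\<phi> has_real_derivative deriv \<phi> t) (at t)" using DERIV_imp_deriv by fastforce
    have "\<forall>\<^sub>F s in nhds t. h' s = deriv \<phi> s"
      using h'(1) by eventually_elim (simp add: DERIV_imp_deriv)
    then have "(deriv \<phi> has_real_derivative d) (at t)"
      using DERIV_cong_ev[of t t h' "deriv \<phi>" d] h'(2) by simp
    then show "\<exists>d\<le>L. (deriv \<phi> has_real_derivative d) (at t)" using h'(3) by blast
  qed
  \<comment> \<open>The derivative of \<open>R x\<close> at 0 is taken within the tangent space, so
    the chain rule is applied within the range of the ray, which lies inside it.\<close>
  have dc: "((\<lambda>s. R x (s *\<^sub>R \<eta>)) has_vector_derivative \<eta>) (at 0)"
  proof -
    have "((\<lambda>s. s *\<^sub>R \<eta>) has_derivative (\<lambda>h. h *\<^sub>R \<eta>)) (at 0)"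
      by (auto intro!: derivative_eq_intros)
    moreover have "(R x has_derivative (\<lambda>\<xi>. \<xi>)) (at (0 *\<^sub>R \<eta>) within range (\<lambda>s. s *\<^sub>R \<eta>))"
      using has_derivative_subset[OF dR, of "range (\<lambda>s. s *\<^sub>R \<eta>)"] ray by (simp add: image_subset_iff)
    ultimately show ?thesis
      unfolding has_vector_derivative_def
      using has_derivative_in_compose[of "\<lambda>s. s *\<^sub>R \<eta>" "\<lambda>h. h *\<^sub>R \<eta>" 0 UNIV "R x" "\<lambda>\<xi>. \<xi>"] by simp
  qed
  have "(\<phi> has_real_derivative (rgrad M f x \<bullet> \<eta>)) (at 0)"
    unfolding \<phi>_def
    by (rule rgrad_along_curve[OF M f x \<eta>(1) _ dc]) (use R0 RM in auto)
  then have d0: "deriv \<phi> 0 = rgrad M f x \<bullet> \<eta>" by (rule DERIV_imp_deriv)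
  have "\<phi> (norm \<xi>) \<le> \<phi> 0 + norm \<xi> * deriv \<phi> 0 + L / 2 * (norm \<xi>)\<^sup>2"
    by (rule second_order_upper_bound) (use der der2 in auto)
  moreover have "norm \<xi> * deriv \<phi> 0 = rgrad M f x \<bullet> \<xi>"
    using \<eta>(3) unfolding d0 by (metis inner_scaleR_right)
  ultimately show ?thesis
    using \<eta>(3) R0 by (simp add: \<phi>_def)
qed

section \<open>Measurability of the iteration\<close>

text \<open>Continuity on \<open>A\<close> makes \<open>h\<close> Borel on the restricted space, and
  the pair takes its values there; the values of \<open>h\<close> elsewhere are arbitrary.\<close>

lemma borel_measurable_continuous_on_pair:
  fixes h :: "'a::second_countable_topology \<Rightarrow> 'b::second_countable_topology \<Rightarrow> 'c::topological_space"
  assumes h: "continuous_on A (\<lambda>(x, z). h x z)"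
    and X: "X \<in> borel_measurable Q" and Z: "Z \<in> borel_measurable Q"
    and A: "\<And>\<omega>. \<omega> \<in> space Q \<Longrightarrow> (X \<omega>, Z \<omega>) \<in> A"
  shows "(\<lambda>\<omega>. h (X \<omega>) (Z \<omega>)) \<in> borel_measurable Q"
proof -
  have "(\<lambda>\<omega>. (X \<omega>, Z \<omega>)) \<in> measurable Q (restrict_space borel A)"
    by (rule measurable_restrict_space2) (use A X Z in \<open>auto intro: borel_measurable_Pair\<close>)
  from measurable_compose[OF this borel_measurable_continuous_on_restrict[OF h]]
  show ?thesis by simp
qed

lemma borel_measurable_restrict_space_borelD:
  "X \<in> measurable Q (restrict_space borel M) \<Longrightarrow> X \<in> borel_measurable Q"
  "X \<in> measurable Q (restrict_space borel M) \<Longrightarrow> \<omega> \<in> space Q \<Longrightarrow> X \<omega> \<in> M"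
  by (auto simp: measurable_restrict_space2_iff)

lemma borel_measurable_orth_proj_tangent_space:
  assumes "embedded_submanifold M" "X \<in> measurable Q (restrict_space borel M)" "Z \<in> borel_measurable Q"
  shows "(\<lambda>\<omega>. orth_proj (tangent_space M (X \<omega>)) (Z \<omega>)) \<in> borel_measurable Q"
  using borel_measurable_continuous_on_pair[OF continuous_on_orth_proj_tangent_space[OF assms(1)] _ assms(3)]
    borel_measurable_restrict_space_borelD[OF assms(2)] by simp

lemma measurable_retraction:
  assumes R: "manifold_retraction M R" and X: "X \<in> measurable Q (restrict_space borel M)"
    and Z: "Z \<in> borel_measurable Q" "\<And>\<omega>. \<omega> \<in> space Q \<Longrightarrow> Z \<omega> \<in> tangent_space M (X \<omega>)"
  shows "(\<lambda>\<omega>. R (X \<omega>) (Z \<omega>)) \<in> measurable Q (restrict_space borel M)"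
proof (rule measurable_restrict_space2)
  note XM = borel_measurable_restrict_space_borelD[OF X]
  show "(\<lambda>\<omega>. R (X \<omega>) (Z \<omega>)) \<in> space Q \<rightarrow> M"
    using R XM(2) Z(2) unfolding manifold_retraction_def by blast
  have "continuous_on (tangent_bundle M) (\<lambda>(x, \<xi>). R x \<xi>)"
    using R C_map_on_continuous unfolding manifold_retraction_def by auto
  then show "(\<lambda>\<omega>. R (X \<omega>) (Z \<omega>)) \<in> borel_measurable Q"
    by (rule borel_measurable_continuous_on_pair) (use XM Z in \<open>auto simp: tangent_bundle_def\<close>)
qed

lemma borel_measurable_C_map_on:
  assumes "C_map_on k M f" "X \<in> measurable Q (restrict_space borel M)"
  shows "(\<lambda>\<omega>. f (X \<omega>)) \<in> borel_measurable Q"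
  by (rule measurable_compose[OF assms(2) borel_measurable_continuous_on_restrict])
    (rule C_map_on_continuous[OF assms(1)])

lemma borel_measurable_vec_iff:
  fixes F :: "'w \<Rightarrow> ('a::euclidean_space)^'n"
  shows "F \<in> borel_measurable Q \<longleftrightarrow> (\<forall>i. (\<lambda>\<omega>. F \<omega> $ i) \<in> borel_measurable Q)"
  by (subst borel_measurable_euclidean_space, subst (2) borel_measurable_euclidean_space)
    (auto simp: Basis_vec_def inner_axis)

text \<open>On \<open>M\<close> the gradient is the mean of the stochastic gradient, so joint
  measurability of the latter reduces the claim to a parametrised integral.\<close>

lemma borel_measurable_rgrad:
  assumes D: "prob_space D" and sg: "stochastic_gradient M f D gradf"
    and X: "X \<in> measurable Q (restrict_space borel M)"
  shows "(\<lambda>\<omega>. rgrad M f (X \<omega>)) \<in> borel_measurable Q"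
proof -
  interpret prob_space D by fact
  have [measurable]: "(\<lambda>(i, x). gradf i x) \<in> borel_measurable (D \<Otimes>\<^sub>M restrict_space borel M)"
    using sg by (simp add: stochastic_gradient_def)
  note [measurable] = X
  have "(\<lambda>\<omega>. \<integral>i. gradf i (X \<omega>) \<partial>D) \<in> borel_measurable Q"
    by measurable
  moreover have "(\<integral>i. gradf i (X \<omega>) \<partial>D) = rgrad M f (X \<omega>)" if "\<omega> \<in> space Q" for \<omega>
    using sg borel_measurable_restrict_space_borelD(2)[OF X that] by (simp add: stochastic_gradient_def)
  ultimately show ?thesis
    by (simp cong: measurable_cong)
qed

section \<open>One step of the algorithm\<close>

definition scaled_gradient :: "real^'n \<Rightarrow> real^'r^'n \<Rightarrow> real^'r \<Rightarrow> real^'r^'n" where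
  "scaled_gradient lh G rh = diag_mat (vec_powr lh (- 1/4)) ** G ** diag_mat (vec_powr rh (- 1/4))"

definition vhat_of :: "real^'n \<Rightarrow> real^'r \<Rightarrow> real^('r \<times> 'n)" where
  "vhat_of lh rh = kronecker (vec_powr rh (1/2)) (vec_powr lh (1/2))"

definition next_l :: "real \<Rightarrow> real^'n \<Rightarrow> real^'r^'n \<Rightarrow> real^'n" where
  "next_l \<beta> l G = \<beta> *\<^sub>R l + ((1 - \<beta>) / real CARD('r)) *\<^sub>R diag_vec (G ** transpose G)"

definition next_r :: "real \<Rightarrow> real^'r \<Rightarrow> real^'r^'n \<Rightarrow> real^'r" where
  "next_r \<beta> r G = \<beta> *\<^sub>R r + ((1 - \<beta>) / real CARD('n)) *\<^sub>R diag_vec (transpose G ** G)"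

text \<open>With \<open>next_l\<close> and \<open>next_r\<close> this expresses the update as a
  deterministic function of a state and a gradient matrix, so it can be evaluated at every possible
  draw while the state is kept fixed.\<close>

definition next_iterate where
  "next_iterate M R a x lh rh G = R x (- a *\<^sub>R orth_proj (tangent_space M x) (scaled_gradient lh G rh))"

lemma scaled_gradient_component:
  "scaled_gradient lh G rh $ i $ j = (lh $ i) powr (- 1/4) * G $ i $ j * (rh $ j) powr (- 1/4)"
  by (simp add: scaled_gradient_def matrix_matrix_mult_def diag_mat_def vec_powr_def
      if_distrib if_distribR sum.delta' sum.delta cong: if_cong)

lemma sqrt_vhat_of_component:
  "vec_sqrt (vhat_of lh rh) $ k = (rh $ fst k) powr (1/4) * (lh $ snd k) powr (1/4)"
  by (simp add: vec_sqrt_def vhat_of_def kronecker_def vec_powr_def real_sqrt_mult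
      flip: powr_half_sqrt) (simp add: powr_powr)

text \<open>The identity survives vanishing entries, since both sides are then 0.\<close>

lemma vectorize_scaled_gradient:
  "vectorize (scaled_gradient lh G rh) = vec_divide (vectorize G) (vec_sqrt (vhat_of lh rh))"
  by (simp add: vec_eq_iff vectorize_def vec_divide_def scaled_gradient_component
      sqrt_vhat_of_component powr_minus divide_simps)

lemma inner_vectorize: "vectorize A \<bullet> vectorize B = A \<bullet> B"
proof -
  have "vectorize A \<bullet> vectorize B = (\<Sum>(j, i)\<in>UNIV \<times> UNIV. A $ i $ j * B $ i $ j)"
    unfolding inner_vec_def vectorize_def by (simp add: case_prod_beta)
  also have "\<dots> = (\<Sum>j\<in>UNIV. \<Sum>i\<in>UNIV. A $ i $ j * B $ i $ j)"
    by (rule sum.cartesian_product[symmetric])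
  also have "\<dots> = A \<bullet> B"
    by (subst sum.swap) (simp add: inner_vec_def)
  finally show ?thesis .
qed

lemma norm_vectorize: "norm (vectorize A) = norm A"
  by (simp add: norm_eq_sqrt_inner inner_vectorize)

lemma vec_divide_scaleR: "vec_divide (c *\<^sub>R u) v = c *\<^sub>R vec_divide u v"
  by (simp add: vec_divide_def vec_eq_iff)

lemma bounded_linear_vectorize: "bounded_linear (vectorize :: real^'r^'n \<Rightarrow> _)"
  by (intro linear_conv_bounded_linear[THEN iffD1] linearI) (simp_all add: vectorize_def vec_eq_iff)

text \<open>In the quadratic term the projection is nonexpansive, so dropping it only enlarges the
  bound. \<open>lh\<close>, \<open>rh\<close> and \<open>G\<close> are arbitrary, which allows a
  hypothetical draw in place of the actual one.\<close>

lemma next_iterate_descent: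
  assumes M: "embedded_submanifold M" and f: "C_map_on 1 M f" and R: "manifold_retraction M R"
    and L: "upper_hessian_bounded M R M f L" and x: "x \<in> M"
  shows "f (next_iterate M R a x lh rh G) \<le>
      f x - a * (vectorize (rgrad M f x) \<bullet> vec_divide (vectorize G) (vec_sqrt (vhat_of lh rh)))
      + L / 2 * (norm (vec_divide (a *\<^sub>R vectorize G) (vec_sqrt (vhat_of lh rh))))\<^sup>2"
proof -
  let ?T = "tangent_space M x" and ?u = "scaled_gradient lh G rh"
  let ?\<xi> = "- a *\<^sub>R orth_proj ?T ?u"
  have T: "subspace ?T" by (rule subspace_tangent_space[OF M x])
  have "?\<xi> \<in> ?T" by (intro subspace_scale T orth_proj_in)
  from retraction_descent[OF M f R L x this]
  have "f (next_iterate M R a x lh rh G) \<le> f x + rgrad M f x \<bullet> ?\<xi> + L / 2 * (norm ?\<xi>)\<^sup>2"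
    by (simp add: next_iterate_def)
  also have "rgrad M f x \<bullet> ?\<xi> = - a * (rgrad M f x \<bullet> ?u)"
    using inner_orth_proj[OF T rgrad_in[OF M f x]] by simp
  also have "rgrad M f x \<bullet> ?u = vectorize (rgrad M f x) \<bullet> vec_divide (vectorize G) (vec_sqrt (vhat_of lh rh))"
    by (simp add: inner_vectorize flip: vectorize_scaled_gradient)
  also have "L / 2 * (norm ?\<xi>)\<^sup>2 \<le> L / 2 * (norm (vec_divide (a *\<^sub>R vectorize G) (vec_sqrt (vhat_of lh rh))))\<^sup>2"
  proof (intro mult_left_mono power_mono)
    have "norm ?\<xi> = \<bar>a\<bar> * norm (orth_proj ?T ?u)" by simp
    also have "\<dots> \<le> \<bar>a\<bar> * norm ?u" by (intro mult_left_mono norm_orth_proj_le[OF T]) simp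
    also have "\<dots> = norm (a *\<^sub>R vectorize ?u)" by (simp add: norm_vectorize)
    finally show "norm ?\<xi> \<le> norm (vec_divide (a *\<^sub>R vectorize G) (vec_sqrt (vhat_of lh rh)))"
      by (simp only: vec_divide_scaleR vectorize_scaled_gradient)
  qed (use L in \<open>auto simp: upper_hessian_bounded_def\<close>)
  finally show ?thesis by simp
qed

text \<open>The left side pairs the products \<open>u $ k * w $ k\<close>, of absolute value at most
  \<open>H\<^sup>2\<close>, with the changes of scaling, whose absolute values add up to the l1
  norm. Arbitrary \<open>A\<close> and \<open>s\<close> cover scalings that are 0 by
  convention.\<close>

lemma step_size_change_bound:
  fixes u w s A :: "real^'k"
  assumes "norm u \<le> H" "norm w \<le> H"
  shows "(\<chi> k. A $ k * u $ k) \<bullet> w - a * (u \<bullet> vec_divide w s)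
     \<le> H\<^sup>2 * l1_norm (vec_divide (const_vec a) s - A)"
proof -
  have "(\<chi> k. A $ k * u $ k) \<bullet> w - a * (u \<bullet> vec_divide w s)
      = (\<Sum>k\<in>UNIV. (u $ k * w $ k) * (A $ k - a / s $ k))"
    by (simp add: inner_vec_def vec_divide_def sum_distrib_left sum_subtractf[symmetric] algebra_simps)
  also have "\<dots> \<le> (\<Sum>k\<in>UNIV. H\<^sup>2 * \<bar>a / s $ k - A $ k\<bar>)"
  proof (rule sum_mono)
    fix k
    have "\<bar>u $ k\<bar> \<le> H" "\<bar>w $ k\<bar> \<le> H"
      using component_le_norm_cart[of u k] component_le_norm_cart[of w k] assms by auto
    then have "\<bar>u $ k * w $ k\<bar> \<le> H\<^sup>2"
      unfolding abs_mult power2_eq_square by (intro mult_mono) auto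
    then have "\<bar>u $ k * w $ k\<bar> * \<bar>A $ k - a / s $ k\<bar> \<le> H\<^sup>2 * \<bar>a / s $ k - A $ k\<bar>"
      unfolding abs_minus_commute[of "A $ k"] by (rule mult_right_mono) simp
    then show "(u $ k * w $ k) * (A $ k - a / s $ k) \<le> H\<^sup>2 * \<bar>a / s $ k - A $ k\<bar>"
      unfolding abs_mult[symmetric] by (rule order_trans[OF abs_ge_self])
  qed
  also have "\<dots> = H\<^sup>2 * l1_norm (vec_divide (const_vec a) s - A)"
    by (simp add: l1_norm_def vec_divide_def const_vec_def sum_distrib_left)
  finally show ?thesis .
qed

text \<open>Both scalings of an entry of the gradient contain that entry, so the preconditioned
  gradient is bounded however small the gradient is.\<close>

lemma preconditioned_component_bound:
  fixes G :: "real^'r^'n"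
  assumes \<beta>: "0 < \<beta>" "\<beta> < 1" and l: "\<And>i. 0 \<le> l $ i" and r: "\<And>j. 0 \<le> r $ j"
    and lh: "\<And>i. next_l \<beta> l G $ i \<le> lh $ i" and rh: "\<And>j. next_r \<beta> r G $ j \<le> rh $ j"
  shows "\<bar>vec_divide (vectorize G) (vec_sqrt (vhat_of lh rh)) $ k\<bar>
     \<le> 1 / (((1 - \<beta>) / real CARD('n)) powr (1/4) * ((1 - \<beta>) / real CARD('r)) powr (1/4))"
proof -
  obtain j i where k: "k = (j, i)" by fastforce
  define g c d where "g = G $ i $ j" and "c = (1 - \<beta>) / real CARD('n)" and "d = (1 - \<beta>) / real CARD('r)"
  have cd: "c > 0" "d > 0" using \<beta> by (simp_all add: c_def d_def)
  \<comment> \<open>A diagonal entry of \<open>G ** transpose G\<close> is the sum of the squares in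
    a row, so it dominates the square of each entry; columns are treated alike below.\<close>
  have "d * g\<^sup>2 \<le> d * (\<Sum>j\<in>UNIV. (G $ i $ j)\<^sup>2)"
    unfolding g_def using cd by (intro mult_left_mono member_le_sum) auto
  also have "\<dots> = d * (\<Sum>j\<in>UNIV. G $ i $ j * G $ i $ j)" by (simp add: power2_eq_square)
  also have "\<dots> \<le> next_l \<beta> l G $ i"
    using \<beta> l[of i] by (simp add: next_l_def diag_vec_def matrix_matrix_mult_def transpose_def d_def)
  finally have lg: "d * g\<^sup>2 \<le> lh $ i" using lh order_trans by blast
  have "c * g\<^sup>2 \<le> c * (\<Sum>i\<in>UNIV. (G $ i $ j)\<^sup>2)"
    unfolding g_def using cd by (intro mult_left_mono member_le_sum) auto
  also have "\<dots> = c * (\<Sum>i\<in>UNIV. G $ i $ j * G $ i $ j)" by (simp add: power2_eq_square)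
  also have "\<dots> \<le> next_r \<beta> r G $ j"
    using \<beta> r[of j] by (simp add: next_r_def diag_vec_def matrix_matrix_mult_def transpose_def c_def)
  finally have rg: "c * g\<^sup>2 \<le> rh $ j" using rh order_trans by blast
  have root: "(e * g\<^sup>2) powr (1/4) = e powr (1/4) * \<bar>g\<bar> powr (1/2)" if "e > 0" for e
  proof -
    have "(g\<^sup>2) powr (1/4) = (\<bar>g\<bar> powr 2) powr (1/4)" by simp
    also have "\<dots> = \<bar>g\<bar> powr (1/2)" by (simp only: powr_powr) simp
    finally show ?thesis using that by (simp add: powr_mult)
  qed
  \<comment> \<open>The row accumulator and the column accumulator each contribute a factor
    \<open>\<bar>g\<bar> powr (1/2)\<close>; together they cancel the whole entry.\<close>
  have "c powr (1/4) * d powr (1/4) * \<bar>g\<bar> = (c * g\<^sup>2) powr (1/4) * (d * g\<^sup>2) powr (1/4)"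
    using powr_add[of "\<bar>g\<bar>" "1/2" "1/2"] by (simp add: root cd)
  also have "\<dots> \<le> (rh $ j) powr (1/4) * (lh $ i) powr (1/4)"
    using lg rg cd by (intro mult_mono powr_mono2) auto
  \<comment> \<open>If the denominator is 0, so is the quotient, and the bound is trivial.\<close>
  finally have "\<bar>g\<bar> / ((rh $ j) powr (1/4) * (lh $ i) powr (1/4)) \<le> 1 / (c powr (1/4) * d powr (1/4))"
    using cd by (cases "(rh $ j) powr (1/4) * (lh $ i) powr (1/4) = 0")
      (auto simp: field_simps not_le mult_less_0_iff)
  then show ?thesis
    by (simp add: k vec_divide_def vectorize_def sqrt_vhat_of_component abs_mult g_def c_def d_def)
qed

section \<open>Measurability of the update and bounds on the gradient terms\<close>

lemma borel_measurable_vec_operations [measurable (raw)]: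
  fixes u v :: "'w \<Rightarrow> real^'k" and A :: "'w \<Rightarrow> real^'r^'n"
    and lh :: "'w \<Rightarrow> real^'n" and rh :: "'w \<Rightarrow> real^'r"
  shows "u \<in> borel_measurable Q \<Longrightarrow> v \<in> borel_measurable Q \<Longrightarrow> (\<lambda>\<omega>. vec_max (u \<omega>) (v \<omega>)) \<in> borel_measurable Q"
    and "u \<in> borel_measurable Q \<Longrightarrow> v \<in> borel_measurable Q \<Longrightarrow> (\<lambda>\<omega>. vec_divide (u \<omega>) (v \<omega>)) \<in> borel_measurable Q"
    and "u \<in> borel_measurable Q \<Longrightarrow> (\<lambda>\<omega>. vec_sqrt (u \<omega>)) \<in> borel_measurable Q"
    and "u \<in> borel_measurable Q \<Longrightarrow> (\<lambda>\<omega>. l1_norm (u \<omega>)) \<in> borel_measurable Q"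
    and "A \<in> borel_measurable Q \<Longrightarrow> (\<lambda>\<omega>. vectorize (A \<omega>)) \<in> borel_measurable Q"
    and "lh \<in> borel_measurable Q \<Longrightarrow> rh \<in> borel_measurable Q \<Longrightarrow> (\<lambda>\<omega>. vhat_of (lh \<omega>) (rh \<omega>)) \<in> borel_measurable Q"
    and "lh \<in> borel_measurable Q \<Longrightarrow> A \<in> borel_measurable Q \<Longrightarrow> (\<lambda>\<omega>. next_l \<beta> (lh \<omega>) (A \<omega>)) \<in> borel_measurable Q"
    and "rh \<in> borel_measurable Q \<Longrightarrow> A \<in> borel_measurable Q \<Longrightarrow> (\<lambda>\<omega>. next_r \<beta> (rh \<omega>) (A \<omega>)) \<in> borel_measurable Q"
    and "lh \<in> borel_measurable Q \<Longrightarrow> A \<in> borel_measurable Q \<Longrightarrow> rh \<in> borel_measurable Q \<Longrightarrow>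
      (\<lambda>\<omega>. scaled_gradient (lh \<omega>) (A \<omega>) (rh \<omega>)) \<in> borel_measurable Q"
  by (auto simp: vec_max_def vec_divide_def vec_sqrt_def l1_norm_def vectorize_def vhat_of_def kronecker_def
      vec_powr_def next_l_def next_r_def diag_vec_def matrix_matrix_mult_def transpose_def
      scaled_gradient_component borel_measurable_vec_iff
      intro!: borel_measurable_max borel_measurable_divide measurable_compose[OF _ borel_measurable_sqrt] borel_measurable_sum
        borel_measurable_abs borel_measurable_times borel_measurable_add powr_real_measurable)

lemma measurable_next_iterate:
  assumes M: "embedded_submanifold M" and R: "manifold_retraction M R"
    and X: "X \<in> measurable Q (restrict_space borel M)"
    and [measurable]: "lh \<in> borel_measurable Q" "rh \<in> borel_measurable Q" "G \<in> borel_measurable Q"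
  shows "(\<lambda>\<omega>. next_iterate M R a (X \<omega>) (lh \<omega>) (rh \<omega>) (G \<omega>)) \<in> measurable Q (restrict_space borel M)"
  unfolding next_iterate_def
proof (rule measurable_retraction[OF R X])
  have "(\<lambda>\<omega>. orth_proj (tangent_space M (X \<omega>)) (scaled_gradient (lh \<omega>) (G \<omega>) (rh \<omega>))) \<in> borel_measurable Q"
    by (rule borel_measurable_orth_proj_tangent_space[OF M X]) measurable
  then show "(\<lambda>\<omega>. - a *\<^sub>R orth_proj (tangent_space M (X \<omega>)) (scaled_gradient (lh \<omega>) (G \<omega>) (rh \<omega>))) \<in> borel_measurable Q"
    by measurable
  show "- a *\<^sub>R orth_proj (tangent_space M (X \<omega>)) (scaled_gradient (lh \<omega>) (G \<omega>) (rh \<omega>)) \<in> tangent_space M (X \<omega>)"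
    if "\<omega> \<in> space Q" for \<omega>
    using borel_measurable_restrict_space_borelD(2)[OF X that]
    by (intro subspace_scale orth_proj_in subspace_tangent_space M)
qed

lemma borel_measurable_stochastic_gradient:
  assumes "stochastic_gradient M f D gradf" "J \<in> measurable Q D" "X \<in> measurable Q (restrict_space borel M)"
  shows "(\<lambda>\<omega>. gradf (J \<omega>) (X \<omega>)) \<in> borel_measurable Q"
  using measurable_compose[OF measurable_Pair[OF assms(2,3)], of "\<lambda>(i, x). gradf i x" borel] assms(1)
  by (simp add: stochastic_gradient_def)

lemma norm_rgrad_le:
  assumes "prob_space D" "stochastic_gradient M f D gradf" "x \<in> M"
    and H: "\<And>i. i \<in> space D \<Longrightarrow> norm (gradf i x) \<le> H"
  shows "norm (rgrad M f x) \<le> H"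
proof -
  interpret prob_space D by fact
  have int: "integrable D (\<lambda>i. gradf i x)" and eq: "(\<integral>i. gradf i x \<partial>D) = rgrad M f x"
    using assms(2,3) by (auto simp: stochastic_gradient_def)
  have "norm (\<integral>i. gradf i x \<partial>D) \<le> (\<integral>i. norm (gradf i x) \<partial>D)"
    by (rule integral_norm_bound)
  also have "\<dots> \<le> (\<integral>i. H \<partial>D)"
    by (rule integral_mono) (use int H in auto)
  finally show ?thesis by (simp add: eq prob_space)
qed

text \<open>Estimating coordinate by coordinate brings in the dimension, which is harmless because
  the bound enters only the constant.\<close>

lemma neg_inner_le_card:
  fixes u v :: "real^'k"
  assumes "norm u \<le> H" "\<And>k. \<bar>v $ k\<bar> \<le> K"
  shows "- (u \<bullet> v) \<le> real CARD('k) * (H * K)"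
proof -
  have "- (u \<bullet> v) \<le> (\<Sum>k\<in>UNIV. \<bar>u $ k * v $ k\<bar>)"
    unfolding inner_vec_def inner_real_def by (rule order_trans[OF abs_ge_minus_self sum_abs])
  also have "\<dots> \<le> (\<Sum>k\<in>(UNIV::'k set). H * K)"
  proof (rule sum_mono)
    fix k
    have "\<bar>u $ k\<bar> \<le> H" using component_le_norm_cart[of u k] assms(1) by auto
    then show "\<bar>u $ k * v $ k\<bar> \<le> H * K"
      unfolding abs_mult using assms(2)[of k] by (intro mult_mono) auto
  qed
  finally show ?thesis by simp
qed

section \<open>Averaging over a fresh draw\<close>

text \<open>With the past frozen the coefficient \<open>c\<close> is a constant, so the signed term is bounded;
  the integrability of the preconditioner over the past is never needed.\<close>

lemma (in prob_space) nn_integral_descent_step: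
  fixes X :: "'a \<Rightarrow> 'b::euclidean_space"
  assumes X: "integrable M X" "\<And>i. i \<in> space M \<Longrightarrow> norm (X i) \<le> H"
    and [measurable]: "z' \<in> borel_measurable M" "w \<in> borel_measurable M"
    and step: "\<And>i. i \<in> space M \<Longrightarrow> z' i + c \<bullet> X i \<le> z + w i"
    and nonneg: "\<And>i. i \<in> space M \<Longrightarrow> 0 \<le> z' i" "\<And>i. i \<in> space M \<Longrightarrow> 0 \<le> w i" "0 \<le> z" "0 \<le> c \<bullet> expectation X"
  shows "(\<integral>\<^sup>+i. ennreal (z' i) \<partial>M) + ennreal (c \<bullet> expectation X) \<le> ennreal z + (\<integral>\<^sup>+i. ennreal (w i) \<partial>M)"
proof -
  have [measurable]: "X \<in> borel_measurable M" using X(1) by auto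
  \<comment> \<open>\<open>B\<close> bounds the absolute value of \<open>c \<bullet> X i\<close>, so
    adding it makes the signed integrand nonnegative. Being finite, it can be cancelled in
    \<open>ennreal\<close> at the end.\<close>
  define B where "B = norm c * H"
  obtain i0 where "i0 \<in> space M" using not_empty by blast
  then have "0 \<le> H" using X(2) norm_ge_zero order_trans by blast
  then have B: "0 \<le> B" by (simp add: B_def)
  have cX: "0 \<le> c \<bullet> X i + B" if "i \<in> space M" for i
  proof -
    have "\<bar>c \<bullet> X i\<bar> \<le> B"
      unfolding B_def by (rule order_trans[OF Cauchy_Schwarz_ineq2 mult_left_mono[OF X(2)[OF that]]]) simp
    then show ?thesis by simp
  qed
  have "(\<integral>\<^sup>+i. ennreal (c \<bullet> X i + B) \<partial>M) = ennreal (\<integral>i. c \<bullet> X i + B \<partial>M)"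
    by (rule nn_integral_eq_integral) (use X(1) cX in auto)
  also have "(\<integral>i. c \<bullet> X i + B \<partial>M) = c \<bullet> expectation X + B"
    using X(1) by (simp add: prob_space)
  finally have int: "(\<integral>\<^sup>+i. ennreal (c \<bullet> X i + B) \<partial>M) = ennreal (c \<bullet> expectation X) + ennreal B"
    using nonneg B by simp
  have "(\<integral>\<^sup>+i. ennreal (z' i) \<partial>M) + (ennreal (c \<bullet> expectation X) + ennreal B)
      = (\<integral>\<^sup>+i. ennreal (z' i) + ennreal (c \<bullet> X i + B) \<partial>M)"
    unfolding int[symmetric] by (rule nn_integral_add[symmetric]) auto
  also have "\<dots> \<le> (\<integral>\<^sup>+i. ennreal (z + B) + ennreal (w i) \<partial>M)"
  proof (rule nn_integral_mono)
    fix i assume i: "i \<in> space M"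
    have "ennreal (z' i) + ennreal (c \<bullet> X i + B) = ennreal (z' i + (c \<bullet> X i + B))"
      using nonneg(1) cX i by simp
    also have "\<dots> \<le> ennreal ((z + B) + w i)"
      using step[OF i] by (intro ennreal_leI) simp
    also have "\<dots> = ennreal (z + B) + ennreal (w i)"
      using nonneg(2)[OF i] nonneg(3) B by simp
    finally show "ennreal (z' i) + ennreal (c \<bullet> X i + B) \<le> ennreal (z + B) + ennreal (w i)" .
  qed
  also have "\<dots> = ennreal (z + B) + (\<integral>\<^sup>+i. ennreal (w i) \<partial>M)"
    by (subst nn_integral_add) (auto simp: emeasure_space_1)
  also have "\<dots> = (ennreal z + (\<integral>\<^sup>+i. ennreal (w i) \<partial>M)) + ennreal B"
    using nonneg(3) B by (simp add: ac_simps)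
  finally have "ennreal B + ((\<integral>\<^sup>+i. ennreal (z' i) \<partial>M) + ennreal (c \<bullet> expectation X))
      \<le> ennreal B + (ennreal z + (\<integral>\<^sup>+i. ennreal (w i) \<partial>M))"
    by (simp only: ac_simps)
  then show ?thesis
    by (simp only: ennreal_add_left_cancel_le) simp
qed

text \<open>Independence makes the joint law of the past and the draw a product measure, and
  Tonelli's theorem separates the two integrations. Infinite values of \<open>h\<close> are
  allowed.\<close>

lemma (in prob_space) nn_integral_fresh:
  fixes F :: "'a measure" and D :: "'i measure"
  assumes rv: "(\<lambda>\<omega>. \<omega>) \<in> measurable M F" "Y \<in> measurable M D" and law: "distr M D Y = D"
    and sF: "space F = space M"
    and ind: "\<And>A B. A \<in> sets F \<Longrightarrow> B \<in> sets D \<Longrightarrow> prob (A \<inter> Y -` B) = prob A * prob (Y -` B \<inter> space M)"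
    and h: "h \<in> borel_measurable (F \<Otimes>\<^sub>M D)"
  shows "(\<integral>\<^sup>+\<omega>. h (\<omega>, Y \<omega>) \<partial>M) = (\<integral>\<^sup>+\<omega>. (\<integral>\<^sup>+i. h (\<omega>, i) \<partial>D) \<partial>M)"
proof -
  note [measurable] = rv
  interpret D: prob_space D
    using prob_space_distr[OF rv(2)] law by simp
  \<comment> \<open>Transport along the identity puts the ambient probability on the sigma-algebra
    of \<open>F\<close>.\<close>
  let ?F = "distr M F (\<lambda>\<omega>. \<omega>)"
  have prod: "?F \<Otimes>\<^sub>M D = distr M (F \<Otimes>\<^sub>M D) (\<lambda>\<omega>. (\<omega>, Y \<omega>))"
  proof (rule pair_measure_eqI)
    interpret F: prob_space ?F by (rule prob_space_distr[OF rv(1)])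
    show "sigma_finite_measure ?F" "sigma_finite_measure D" by unfold_locales
    fix A B assume "A \<in> sets ?F" and B: "B \<in> sets D"
    then have A: "A \<in> sets F" by simp
    have sA: "A \<subseteq> space M"
      using sets.sets_into_space[OF A] sF by simp
    have eA: "emeasure ?F A = prob A"
      using A sA by (subst emeasure_distr[OF rv(1)]) (auto simp: emeasure_eq_measure Int_absorb2)
    have eB: "emeasure D B = prob (Y -` B \<inter> space M)"
      using emeasure_distr[OF rv(2) B] by (simp add: law emeasure_eq_measure)
    have "(\<lambda>\<omega>. (\<omega>, Y \<omega>)) -` (A \<times> B) \<inter> space M = A \<inter> Y -` B"
      using sA by auto
    then show "emeasure ?F A * emeasure D B = emeasure (distr M (F \<Otimes>\<^sub>M D) (\<lambda>\<omega>. (\<omega>, Y \<omega>))) (A \<times> B)"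
      using A B by (subst emeasure_distr) (auto simp: eA eB emeasure_eq_measure ind ennreal_mult)
  qed (simp cong: sets_pair_measure_cong)
  have h': "h \<in> borel_measurable (?F \<Otimes>\<^sub>M D)"
    using h by (simp cong: measurable_cong_sets sets_pair_measure_cong)
  have "(\<integral>\<^sup>+\<omega>. h (\<omega>, Y \<omega>) \<partial>M) = integral\<^sup>N (?F \<Otimes>\<^sub>M D) h"
    unfolding prod by (subst nn_integral_distr) (use h in auto)
  also have "\<dots> = (\<integral>\<^sup>+\<omega>. (\<integral>\<^sup>+i. h (\<omega>, i) \<partial>D) \<partial>?F)"
    by (rule D.nn_integral_fst[OF h', symmetric])
  also have "\<dots> = (\<integral>\<^sup>+\<omega>. (\<integral>\<^sup>+i. h (\<omega>, i) \<partial>D) \<partial>M)"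
    by (rule nn_integral_distr[OF rv(1)]) (use D.borel_measurable_nn_integral_fst[OF h] in simp)
  finally show ?thesis .
qed

text \<open>The hypothesis compares averages over a hypothetical draw for each frozen past;
  integrating over the past replaces that draw by the actual \<open>Y\<close>.\<close>

lemma (in prob_space) nn_integral_fresh_step:
  fixes F :: "'a measure" and D :: "'i measure"
  assumes rv: "(\<lambda>\<omega>. \<omega>) \<in> measurable M F" "Y \<in> measurable M D" and law: "distr M D Y = D"
    and sF: "space F = space M"
    and ind: "\<And>A B. A \<in> sets F \<Longrightarrow> B \<in> sets D \<Longrightarrow> prob (A \<inter> Y -` B) = prob A * prob (Y -` B \<inter> space M)"
    and z': "z' \<in> borel_measurable (F \<Otimes>\<^sub>M D)" and w: "w \<in> borel_measurable (F \<Otimes>\<^sub>M D)"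
    and z: "z \<in> borel_measurable F" and u: "u \<in> borel_measurable F"
    and step: "\<And>\<omega>. \<omega> \<in> space M \<Longrightarrow> (\<integral>\<^sup>+i. z' (\<omega>, i) \<partial>D) + u \<omega> \<le> z \<omega> + (\<integral>\<^sup>+i. w (\<omega>, i) \<partial>D)"
  shows "(\<integral>\<^sup>+\<omega>. z' (\<omega>, Y \<omega>) \<partial>M) + (\<integral>\<^sup>+\<omega>. u \<omega> \<partial>M) \<le> (\<integral>\<^sup>+\<omega>. z \<omega> \<partial>M) + (\<integral>\<^sup>+\<omega>. w (\<omega>, Y \<omega>) \<partial>M)"
proof -
  interpret D: prob_space D
    using prob_space_distr[OF rv(2)] law by simp
  note meas = measurable_compose[OF rv(1)]
  have "(\<integral>\<^sup>+\<omega>. (\<integral>\<^sup>+i. z' (\<omega>, i) \<partial>D) + u \<omega> \<partial>M) \<le> (\<integral>\<^sup>+\<omega>. z \<omega> + (\<integral>\<^sup>+i. w (\<omega>, i) \<partial>D) \<partial>M)"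
    by (rule nn_integral_mono) (rule step)
  moreover have "(\<integral>\<^sup>+\<omega>. (\<integral>\<^sup>+i. z' (\<omega>, i) \<partial>D) + u \<omega> \<partial>M) = (\<integral>\<^sup>+\<omega>. z' (\<omega>, Y \<omega>) \<partial>M) + (\<integral>\<^sup>+\<omega>. u \<omega> \<partial>M)"
    using meas[OF D.borel_measurable_nn_integral_fst[OF z']] meas[OF u]
    by (simp add: nn_integral_add nn_integral_fresh[OF rv law sF ind z'])
  moreover have "(\<integral>\<^sup>+\<omega>. z \<omega> + (\<integral>\<^sup>+i. w (\<omega>, i) \<partial>D) \<partial>M) = (\<integral>\<^sup>+\<omega>. z \<omega> \<partial>M) + (\<integral>\<^sup>+\<omega>. w (\<omega>, Y \<omega>) \<partial>M)"
    using meas[OF D.borel_measurable_nn_integral_fst[OF w]] meas[OF z]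
    by (simp add: nn_integral_add nn_integral_fresh[OF rv law sF ind w])
  ultimately show ?thesis by simp
qed

text \<open>The sigma-algebra of the draws strictly before \<open>t\<close>, packaged as a measure
  so that it can serve as a source of measurable functions and as a factor of a product
  space.\<close>

definition past :: "'w measure \<Rightarrow> 'i measure \<Rightarrow> (nat \<Rightarrow> 'w \<Rightarrow> 'i) \<Rightarrow> nat \<Rightarrow> 'w measure" where
  "past P D draw t =
     vimage_algebra (space P) (\<lambda>\<omega>. restrict (\<lambda>s. draw s \<omega>) {1..<t}) (PiM {1..<t} (\<lambda>_. D))"

lemma space_past [simp]: "space (past P D draw t) = space P"
  by (simp add: past_def)

context prob_space
begin

context
  fixes D :: "'i measure" and draw :: "nat \<Rightarrow> 'a \<Rightarrow> 'i"
  assumes ind: "indep_vars (\<lambda>_. D) draw {1..}"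
begin

lemma measurable_draw: "1 \<le> t \<Longrightarrow> draw t \<in> measurable M D"
  using ind by (auto simp: indep_vars_def)

lemma restrict_draw_measurable:
  "(\<lambda>\<omega>. restrict (\<lambda>s. draw s \<omega>) {1..<t}) \<in> measurable M (PiM {1..<t} (\<lambda>_. D))"
  by (rule measurable_restrict) (simp add: measurable_draw)

lemma measurable_past_imp: "X \<in> measurable (past M D draw t) N \<Longrightarrow> X \<in> measurable M N"
  using measurable_mono[OF order_refl refl, of "past M D draw t" M N]
    sets_image_in_sets[OF refl restrict_draw_measurable, of t]
  by (auto simp: past_def)

lemma measurable_draw_past:
  assumes "1 \<le> s" "s < t"
  shows "draw s \<in> measurable (past M D draw t) D"
proof -
  have "(\<lambda>\<omega>. restrict (\<lambda>s. draw s \<omega>) {1..<t}) \<in> measurable (past M D draw t) (PiM {1..<t} (\<lambda>_. D))"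
    unfolding past_def using measurable_space[OF restrict_draw_measurable]
    by (intro measurable_vimage_algebra1) auto
  from measurable_compose[OF this measurable_component_singleton, of s]
  show ?thesis using assms by simp
qed

lemma measurable_past_mono:
  assumes "s \<le> t" "X \<in> measurable (past M D draw s) N"
  shows "X \<in> measurable (past M D draw t) N"
proof -
  have "(\<lambda>\<omega>. \<omega>) \<in> measurable (past M D draw t) (past M D draw s)"
    unfolding past_def[of _ _ _ s]
  proof (rule measurable_vimage_algebra2)
    show "(\<lambda>\<omega>. restrict (\<lambda>s. draw s \<omega>) {1..<s}) \<in> measurable (past M D draw t) (PiM {1..<s} (\<lambda>_. D))"
      by (rule measurable_restrict) (use assms(1) in \<open>auto intro: measurable_draw_past\<close>)
  qed simp
  from measurable_compose[OF this assms(2)] show ?thesis .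
qed

text \<open>Independence of the single draws is regrouped into independence of the tuple of earlier
  draws and the one-element tuple at \<open>t\<close>; \<open>B'\<close> is \<open>B\<close> read as
  an event about the latter.\<close>

lemma prob_past_draw:
  assumes t: "1 \<le> t" and A: "A \<in> sets (past M D draw t)" and B: "B \<in> sets D"
  shows "prob (A \<inter> draw t -` B) = prob A * prob (draw t -` B \<inter> space M)"
proof -
  let ?X = "\<lambda>s \<omega>. restrict (\<lambda>s. draw s \<omega>) s" and ?N = "\<lambda>s. PiM s (\<lambda>_. D)"
  have ind': "indep_var (?N {1..<t}) (?X {1..<t}) (?N {t}) (?X {t})"
    by (rule indep_var_restrict[OF ind]) (use t in auto)
  obtain A' where A': "A' \<in> sets (?N {1..<t})" "A = ?X {1..<t} -` A' \<inter> space M"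
    using A measurable_space[OF restrict_draw_measurable]
    by (auto simp: past_def sets_vimage_algebra2 Pi_iff)
  define B' where "B' = (\<lambda>h. h t) -` B \<inter> space (?N {t})"
  have B': "B' \<in> sets (?N {t})"
    unfolding B'_def using measurable_sets[OF measurable_component_singleton[of t "{t}" "\<lambda>_. D"] B] by simp
  have vB': "?X {t} -` B' \<inter> space M = draw t -` B \<inter> space M"
    using measurable_space[OF measurable_draw[OF t]] by (auto simp: B'_def space_PiM)
  have "A \<inter> draw t -` B = (\<lambda>\<omega>. (?X {1..<t} \<omega>, ?X {t} \<omega>)) -` (A' \<times> B') \<inter> space M"
    using A' vB' by blast
  then show ?thesis
    using indep_varD[OF ind' A'(1) B'] by (simp only: A'(2) vB')
qed

end

end

theorem theorem4p4:
  fixes M :: "(real^'r^'n) set"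
    and R :: "real^'r^'n \<Rightarrow> real^'r^'n \<Rightarrow> real^'r^'n"
    and f :: "real^'r^'n \<Rightarrow> real"
    and D :: "'i measure"
    and gradf :: "'i \<Rightarrow> real^'r^'n \<Rightarrow> real^'r^'n"
    and P :: "'w measure"
    and draw :: "nat \<Rightarrow> 'w \<Rightarrow> 'i"
    and \<alpha> :: "nat \<Rightarrow> real"
    and \<beta> H L :: real
    and x\<^sub>1 :: "real^'r^'n"
    and x :: "nat \<Rightarrow> 'w \<Rightarrow> real^'r^'n"
    and l lhat :: "nat \<Rightarrow> 'w \<Rightarrow> real^'n"
    and r rhat :: "nat \<Rightarrow> 'w \<Rightarrow> real^'r"
    and vhat g gt :: "nat \<Rightarrow> 'w \<Rightarrow> real^('r \<times> 'n)"
  assumes manifold: "embedded_submanifold M"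
    and retraction: "manifold_retraction M R"
    and prob_D: "prob_space D"
    and prob_P: "prob_space P"
    and draws_law: "\<And>t. t \<ge> 1 \<Longrightarrow> distr P D (draw t) = D"
    and draws_indep: "prob_space.indep_vars P (\<lambda>_. D) draw {1..}"
    and stoch_grad: "stochastic_gradient M f D gradf"
    and A1_smooth: "C_map_on 1 M f"
    and A1_bounded: "bdd_below (f ` M)"
    and A2: "\<And>i y. i \<in> space D \<Longrightarrow> y \<in> M \<Longrightarrow> norm (gradf i y) \<le> H"
    and A3: "upper_hessian_bounded M R M f L"
    and step_sizes: "\<And>t. t \<ge> 1 \<Longrightarrow> \<alpha> t > 0"
    and beta: "0 < \<beta>" "\<beta> < 1"
    and init: "x\<^sub>1 \<in> M"
    and algorithm: "\<And>\<omega>. \<omega> \<in> space P \<Longrightarrow>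
        rasa M R \<alpha> \<beta> x\<^sub>1 (\<lambda>t. gradf (draw t \<omega>))
          (\<lambda>t. x t \<omega>) (\<lambda>t. l t \<omega>) (\<lambda>t. lhat t \<omega>) (\<lambda>t. r t \<omega>) (\<lambda>t. rhat t \<omega>)"
    and vhat: "\<And>t \<omega>. vhat t \<omega> = kronecker (vec_powr (rhat t \<omega>) (1/2)) (vec_powr (lhat t \<omega>) (1/2))"
    and g: "\<And>t \<omega>. g t \<omega> = vectorize (rgrad M f (x t \<omega>))"
    and gt: "\<And>t \<omega>. gt t \<omega> = vectorize (gradf (draw t \<omega>) (x t \<omega>))"
  shows "\<exists>C::real. 0 \<le> C \<and> (\<forall>T\<ge>1.
      (\<integral>\<^sup>+\<omega>. ennreal
          (\<Sum>t=2..T. \<alpha> (t - 1) * (g t \<omega> \<bullet> vec_divide (g t \<omega>) (vec_sqrt (vhat (t - 1) \<omega>)))) \<partial>P)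
      \<le> (\<integral>\<^sup>+\<omega>. ennreal
          (L / 2 * (\<Sum>t=1..T. (norm (vec_divide (\<alpha> t *\<^sub>R gt t \<omega>) (vec_sqrt (vhat t \<omega>))))\<^sup>2)
           + H\<^sup>2 * (\<Sum>t=2..T. l1_norm
               (vec_divide (const_vec (\<alpha> t)) (vec_sqrt (vhat t \<omega>))
                - vec_divide (const_vec (\<alpha> (t - 1))) (vec_sqrt (vhat (t - 1) \<omega>))))) \<partial>P)
        + ennreal C)"
proof -
  interpret P: prob_space P by fact
  interpret D: prob_space D by fact
  note draw_meas = P.measurable_draw[OF draws_indep]
  have draw_D: "draw t \<omega> \<in> space D" if "\<omega> \<in> space P" "1 \<le> t" for t \<omega>
    using measurable_space[OF draw_meas[OF that(2)] that(1)] .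
  let ?G = "\<lambda>t \<omega>. gradf (draw t \<omega>) (x t \<omega>)"
  let ?step = "next_iterate M R"
  have start: "x 1 \<omega> = x\<^sub>1" "l 0 \<omega> = 0" "lhat 0 \<omega> = 0" "r 0 \<omega> = 0" "rhat 0 \<omega> = 0" if "\<omega> \<in> space P" for \<omega>
    using algorithm[OF that] by (simp_all add: rasa_def)
  have run: "l t \<omega> = next_l \<beta> (l (t - 1) \<omega>) (?G t \<omega>)" "lhat t \<omega> = vec_max (lhat (t - 1) \<omega>) (l t \<omega>)"
      "r t \<omega> = next_r \<beta> (r (t - 1) \<omega>) (?G t \<omega>)" "rhat t \<omega> = vec_max (rhat (t - 1) \<omega>) (r t \<omega>)"
      "x (Suc t) \<omega> = ?step (\<alpha> t) (x t \<omega>) (lhat t \<omega>) (rhat t \<omega>) (?G t \<omega>)"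
    if "\<omega> \<in> space P" "1 \<le> t" for t \<omega>
    using algorithm[OF that(1)] that(2)
    by (simp_all add: rasa_def Let_def next_l_def next_r_def next_iterate_def scaled_gradient_def)
  have vhat_eq: "vhat t \<omega> = vhat_of (lhat t \<omega>) (rhat t \<omega>)" for t \<omega>
    by (simp add: vhat vhat_of_def)

  let ?F = "past P D draw" and ?M = "restrict_space borel M"
  \<comment> \<open>The offset matters: the draws before \<open>t\<close> determine
    \<open>x t\<close>, but the accumulators only up to \<open>t - 1\<close>, because those of index
    \<open>t\<close> already contain draw \<open>t\<close>.\<close>
  have state: "x t \<in> measurable (?F t) ?M \<and> l (t - 1) \<in> borel_measurable (?F t) \<and>
      lhat (t - 1) \<in> borel_measurable (?F t) \<and> r (t - 1) \<in> borel_measurable (?F t) \<and>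
      rhat (t - 1) \<in> borel_measurable (?F t)" if "1 \<le> t" for t
    using that
  proof (induction t rule: dec_induct)
    case base
    have "x\<^sub>1 \<in> space ?M" using init by (simp add: space_restrict_space)
    then have "x 1 \<in> measurable (?F 1) ?M"
      using start(1) by (subst measurable_cong[where g = "\<lambda>_. x\<^sub>1"]) simp_all
    moreover have "l 0 \<in> borel_measurable (?F 1)" "lhat 0 \<in> borel_measurable (?F 1)"
      "r 0 \<in> borel_measurable (?F 1)" "rhat 0 \<in> borel_measurable (?F 1)"
      by (subst measurable_cong[where g = "\<lambda>_. 0"]; simp add: start)+
    ultimately show ?case by simp
  next
    case (step t)
    have mono: "X \<in> measurable (?F (Suc t)) N" if "X \<in> measurable (?F t) N" for X and N :: "'z measure"
      by (rule P.measurable_past_mono[OF draws_indep _ that]) simp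
    have x: "x t \<in> measurable (?F (Suc t)) ?M"
      and [measurable]: "l (t - 1) \<in> borel_measurable (?F (Suc t))" "lhat (t - 1) \<in> borel_measurable (?F (Suc t))"
        "r (t - 1) \<in> borel_measurable (?F (Suc t))" "rhat (t - 1) \<in> borel_measurable (?F (Suc t))"
      using step.IH P.measurable_past_mono[OF draws_indep le_SucI[OF order_refl]] by blast+
    have [measurable]: "?G t \<in> borel_measurable (?F (Suc t))"
      by (rule borel_measurable_stochastic_gradient[OF stoch_grad _ x])
        (use step.hyps in \<open>auto intro!: P.measurable_draw_past[OF draws_indep]\<close>)
    \<comment> \<open>The recursion is given on \<open>space P\<close>, so measurability is
      transferred by \<open>measurable_cong\<close>, here and for the other components.\<close>
    have "l t \<in> borel_measurable (?F (Suc t)) \<longleftrightarrow>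
        (\<lambda>\<omega>. next_l \<beta> (l (t - 1) \<omega>) (?G t \<omega>)) \<in> borel_measurable (?F (Suc t))"
      by (rule measurable_cong) (use step.hyps in \<open>simp add: run\<close>)
    then have [measurable]: "l t \<in> borel_measurable (?F (Suc t))" by (rule iffD2) measurable
    have "r t \<in> borel_measurable (?F (Suc t)) \<longleftrightarrow>
        (\<lambda>\<omega>. next_r \<beta> (r (t - 1) \<omega>) (?G t \<omega>)) \<in> borel_measurable (?F (Suc t))"
      by (rule measurable_cong) (use step.hyps in \<open>simp add: run\<close>)
    then have [measurable]: "r t \<in> borel_measurable (?F (Suc t))" by (rule iffD2) measurable
    have "lhat t \<in> borel_measurable (?F (Suc t)) \<longleftrightarrow>
        (\<lambda>\<omega>. vec_max (lhat (t - 1) \<omega>) (l t \<omega>)) \<in> borel_measurable (?F (Suc t))"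
      by (rule measurable_cong) (use step.hyps in \<open>simp add: run(2)\<close>)
    then have [measurable]: "lhat t \<in> borel_measurable (?F (Suc t))" by (rule iffD2) measurable
    have "rhat t \<in> borel_measurable (?F (Suc t)) \<longleftrightarrow>
        (\<lambda>\<omega>. vec_max (rhat (t - 1) \<omega>) (r t \<omega>)) \<in> borel_measurable (?F (Suc t))"
      by (rule measurable_cong) (use step.hyps in \<open>simp add: run(4)\<close>)
    then have [measurable]: "rhat t \<in> borel_measurable (?F (Suc t))" by (rule iffD2) measurable
    have "x (Suc t) \<in> measurable (?F (Suc t)) ?M \<longleftrightarrow>
        (\<lambda>\<omega>. ?step (\<alpha> t) (x t \<omega>) (lhat t \<omega>) (rhat t \<omega>) (?G t \<omega>)) \<in> measurable (?F (Suc t)) ?M"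
      by (rule measurable_cong) (use step.hyps in \<open>simp add: run(5)\<close>)
    moreover have "(\<lambda>\<omega>. ?step (\<alpha> t) (x t \<omega>) (lhat t \<omega>) (rhat t \<omega>) (?G t \<omega>)) \<in> measurable (?F (Suc t)) ?M"
      by (rule measurable_next_iterate[OF manifold retraction x]) measurable
    ultimately show ?case by simp
  qed

  have xM: "x t \<omega> \<in> M" if "\<omega> \<in> space P" "1 \<le> t" for t \<omega>
    using state[OF that(2)] borel_measurable_restrict_space_borelD(2)[of "x t" "?F t" M \<omega>] that(1) by simp
  have gradf_D: "integrable D (\<lambda>i. gradf i y)" "(\<integral>i. gradf i y \<partial>D) = rgrad M f y" if "y \<in> M" for y
    using stoch_grad that by (auto simp: stochastic_gradient_def)
  have norm_g: "norm (g t \<omega>) \<le> H" if "\<omega> \<in> space P" "1 \<le> t" for t \<omega>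
    unfolding g norm_vectorize by (rule norm_rgrad_le[OF prob_D stoch_grad xM[OF that] A2[OF _ xM[OF that]]])
  obtain m where m: "\<And>y. y \<in> M \<Longrightarrow> m \<le> f y"
    using A1_bounded by (auto simp: bdd_below_def)

  define S where "S t \<omega> = vec_sqrt (vhat t \<omega>)" for t \<omega>
  define A where "A t \<omega> = vec_divide (const_vec (\<alpha> t)) (S t \<omega>)" for t \<omega>
  \<comment> \<open>Shifting by the lower bound \<open>m\<close> makes the gap nonnegative on
    \<open>space P\<close>, ready for integration in \<open>ennreal\<close>.\<close>
  define Z where "Z t \<omega> = f (x t \<omega>) - m" for t \<omega>
  define U where "U t \<omega> = \<alpha> (t - 1) * (g t \<omega> \<bullet> vec_divide (g t \<omega>) (S (t - 1) \<omega>))" for t \<omega>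
  define V where "V t \<omega> = L / 2 * (norm (vec_divide (\<alpha> t *\<^sub>R gt t \<omega>) (S t \<omega>)))\<^sup>2" for t \<omega>
  define W where "W t \<omega> = V t \<omega> + H\<^sup>2 * l1_norm (A t \<omega> - A (t - 1) \<omega>)" for t \<omega>
  have L: "L > 0" using A3 by (simp add: upper_hessian_bounded_def)
  have nonneg: "0 \<le> V t \<omega>" "0 \<le> W t \<omega>" for t \<omega>
    using L by (simp_all add: V_def W_def l1_norm_def sum_nonneg)
  have Z_nonneg: "0 \<le> Z t \<omega>" if "\<omega> \<in> space P" "1 \<le> t" for t \<omega>
    using m[OF xM[OF that]] by (simp add: Z_def)
  \<comment> \<open>The left factor depends on earlier draws only and \<open>g t\<close> is the mean
    of the stochastic gradient, so \<open>U t\<close> is the average of a term linear in the fresh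
    gradient.\<close>
  have U_inner: "U t \<omega> = (\<chi> k. A (t - 1) \<omega> $ k * g t \<omega> $ k) \<bullet> g t \<omega>" for t \<omega>
    by (simp add: U_def A_def inner_vec_def vec_divide_def const_vec_def sum_distrib_left ac_simps)
  have S_nonneg: "0 \<le> S t \<omega> $ k" for t \<omega> k
    by (simp add: S_def vhat_eq sqrt_vhat_of_component)
  \<comment> \<open>Step sizes are positive from index 1 on, so the factor
    \<open>\<alpha> (t - 1)\<close> calls for \<open>2 \<le> t\<close>.\<close>
  have U_nonneg: "0 \<le> U t \<omega>" if "2 \<le> t" for t \<omega>
    using less_imp_le[OF step_sizes[of "t - 1"]] that S_nonneg
    by (auto simp: U_def inner_vec_def vec_divide_def intro!: mult_nonneg_nonneg sum_nonneg)

  have meas: "Z t \<in> borel_measurable (?F t)" "g t \<in> borel_measurable (?F t)"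
    "A (t - 1) \<in> borel_measurable (?F t)" "U t \<in> borel_measurable (?F t)"
    "gt t \<in> borel_measurable (?F (Suc t))" "V t \<in> borel_measurable (?F (Suc t))"
    "W t \<in> borel_measurable (?F (Suc t))" if "1 \<le> t" for t
  proof -
    have [measurable]: "lhat (t - 1) \<in> borel_measurable (?F t)" "rhat (t - 1) \<in> borel_measurable (?F t)"
        "lhat t \<in> borel_measurable (?F (Suc t))" "rhat t \<in> borel_measurable (?F (Suc t))"
      using state[OF that] state[of "Suc t"] by simp_all
    have [measurable]: "S (t - 1) \<in> borel_measurable (?F t)" "S t \<in> borel_measurable (?F (Suc t))"
      unfolding S_def[abs_def] vhat_eq by measurable
    have x: "x t \<in> measurable (?F t) ?M" using state[OF that] by simp
    show "Z t \<in> borel_measurable (?F t)"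
      using borel_measurable_C_map_on[OF A1_smooth x] by (simp add: Z_def[abs_def])
    show g'[measurable]: "g t \<in> borel_measurable (?F t)"
      using borel_measurable_rgrad[OF prob_D stoch_grad x] by (simp add: g[abs_def])
    show A'[measurable]: "A (t - 1) \<in> borel_measurable (?F t)"
      unfolding A_def[abs_def] by measurable
    show "U t \<in> borel_measurable (?F t)"
      unfolding U_def[abs_def] by measurable
    note mono = P.measurable_past_mono[OF draws_indep le_SucI[OF order_refl]]
    have "?G t \<in> borel_measurable (?F (Suc t))"
      by (rule borel_measurable_stochastic_gradient[OF stoch_grad _ mono[OF x]])
        (use that in \<open>auto intro!: P.measurable_draw_past[OF draws_indep]\<close>)
    then show gt'[measurable]: "gt t \<in> borel_measurable (?F (Suc t))"
      by (simp add: gt[abs_def])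
    show V'[measurable]: "V t \<in> borel_measurable (?F (Suc t))"
      unfolding V_def[abs_def] by measurable
    have [measurable]: "A t \<in> borel_measurable (?F (Suc t))"
      unfolding A_def[abs_def] by measurable
    note [measurable] = mono[OF A']
    show "W t \<in> borel_measurable (?F (Suc t))"
      unfolding W_def[abs_def] by measurable
  qed
  note measP = P.measurable_past_imp[OF draws_indep]
  note meas' [measurable] = meas[THEN measP]

  \<comment> \<open>Averaged descent from the second step on\<close>
  have descent: "(\<integral>\<^sup>+\<omega>. ennreal (Z (Suc t) \<omega>) \<partial>P) + (\<integral>\<^sup>+\<omega>. ennreal (U t \<omega>) \<partial>P)
      \<le> (\<integral>\<^sup>+\<omega>. ennreal (Z t \<omega>) \<partial>P) + (\<integral>\<^sup>+\<omega>. ennreal (W t \<omega>) \<partial>P)" if t: "2 \<le> t" for t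
  proof -
    have t1: "1 \<le> t" using t by simp
    \<comment> \<open>The step as a function of a pair: the past is read at \<open>fst p\<close>,
      and the draw is the free variable \<open>snd p\<close>. At
      \<open>(\<omega>, draw t \<omega>)\<close> this is the actual iteration, so \<open>z'\<close>
      and \<open>w\<close> become \<open>Z (Suc t)\<close> and \<open>W t\<close>.\<close>
    let ?G' = "\<lambda>p. gradf (snd p) (x t (fst p))"
    let ?l = "\<lambda>p. vec_max (lhat (t - 1) (fst p)) (next_l \<beta> (l (t - 1) (fst p)) (?G' p))"
    let ?r = "\<lambda>p. vec_max (rhat (t - 1) (fst p)) (next_r \<beta> (r (t - 1) (fst p)) (?G' p))"
    let ?S = "\<lambda>p. vec_sqrt (vhat_of (?l p) (?r p))"
    define z' where "z' p = f (?step (\<alpha> t) (x t (fst p)) (?l p) (?r p) (?G' p)) - m" for p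
    define w where "w p = L / 2 * (norm (vec_divide (\<alpha> t *\<^sub>R vectorize (?G' p)) (?S p)))\<^sup>2 +
        H\<^sup>2 * l1_norm (vec_divide (const_vec (\<alpha> t)) (?S p) - A (t - 1) (fst p))" for p
    let ?Q = "?F t \<Otimes>\<^sub>M D"
    have x: "(\<lambda>p. x t (fst p)) \<in> measurable ?Q ?M"
      using state[OF t1] by (auto intro: measurable_compose[OF measurable_fst])
    have [measurable]: "l (t - 1) \<in> borel_measurable (?F t)" "lhat (t - 1) \<in> borel_measurable (?F t)"
        "r (t - 1) \<in> borel_measurable (?F t)" "rhat (t - 1) \<in> borel_measurable (?F t)"
      using state[OF t1] by simp_all
    note [measurable] = meas(3)[OF t1]
    have [measurable]: "?G' \<in> borel_measurable ?Q"
      by (rule borel_measurable_stochastic_gradient[OF stoch_grad measurable_snd x])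
    have step_meas: "(\<lambda>p. ?step (\<alpha> t) (x t (fst p)) (?l p) (?r p) (?G' p)) \<in> measurable ?Q ?M"
      by (rule measurable_next_iterate[OF manifold retraction x]) measurable
    from borel_measurable_C_map_on[OF A1_smooth step_meas]
    have z'_meas[measurable]: "z' \<in> borel_measurable ?Q"
      unfolding z'_def[abs_def] by measurable
    have w_meas[measurable]: "w \<in> borel_measurable ?Q"
      unfolding w_def[abs_def] by measurable
    have z'_draw: "z' (\<omega>, draw t \<omega>) = Z (Suc t) \<omega>" and w_draw: "w (\<omega>, draw t \<omega>) = W t \<omega>"
      if "\<omega> \<in> space P" for \<omega>
      using run[OF that t1] by (simp_all add: z'_def w_def Z_def W_def V_def A_def S_def vhat_eq gt)
    \<comment> \<open>Here \<open>\<omega>\<close> is fixed and only \<open>i\<close> varies, so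
      \<open>A (t - 1) \<omega>\<close> is a constant vector, however large.\<close>
    have inner_step: "(\<integral>\<^sup>+i. ennreal (z' (\<omega>, i)) \<partial>D) + ennreal (U t \<omega>)
        \<le> ennreal (Z t \<omega>) + (\<integral>\<^sup>+i. ennreal (w (\<omega>, i)) \<partial>D)" if \<omega>: "\<omega> \<in> space P" for \<omega>
    proof -
      note xM' = xM[OF \<omega> t1]
      let ?c = "\<chi> k. A (t - 1) \<omega> $ k * g t \<omega> $ k" and ?X = "\<lambda>i. vectorize (gradf i (x t \<omega>))"
      have X: "integrable D ?X" "(\<integral>i. ?X i \<partial>D) = g t \<omega>"
        using integrable_bounded_linear[OF bounded_linear_vectorize gradf_D(1)[OF xM']]
          integral_bounded_linear[OF bounded_linear_vectorize gradf_D(1)[OF xM']] gradf_D(2)[OF xM']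
        by (simp_all add: g)
      have "(\<integral>\<^sup>+i. ennreal (z' (\<omega>, i)) \<partial>D) + ennreal (?c \<bullet> (\<integral>i. ?X i \<partial>D))
          \<le> ennreal (Z t \<omega>) + (\<integral>\<^sup>+i. ennreal (w (\<omega>, i)) \<partial>D)"
      proof (rule D.nn_integral_descent_step[OF X(1)])
        show "norm (?X i) \<le> H" if "i \<in> space D" for i
          using A2[OF that xM'] by (simp add: norm_vectorize)
        have "(\<lambda>i. (\<omega>, i)) \<in> measurable D ?Q"
          using \<omega> by (intro measurable_Pair1') simp
        then show "(\<lambda>i. z' (\<omega>, i)) \<in> borel_measurable D" "(\<lambda>i. w (\<omega>, i)) \<in> borel_measurable D"
          using measurable_compose z'_meas w_meas by blast+
        show "0 \<le> Z t \<omega>" by (rule Z_nonneg[OF \<omega> t1])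
        show "0 \<le> ?c \<bullet> (\<integral>i. ?X i \<partial>D)"
          using U_nonneg[OF t] by (simp add: X(2) U_inner)
        fix i assume i: "i \<in> space D"
        show "0 \<le> w (\<omega>, i)"
          using L by (simp add: w_def l1_norm_def sum_nonneg)
        have "(\<omega>, i) \<in> space ?Q" using \<omega> i by (simp add: space_pair_measure)
        then have "?step (\<alpha> t) (x t \<omega>) (?l (\<omega>, i)) (?r (\<omega>, i)) (gradf i (x t \<omega>)) \<in> M"
          using borel_measurable_restrict_space_borelD(2)[OF step_meas, of "(\<omega>, i)"]
          by simp
        then show "0 \<le> z' (\<omega>, i)"
          using m by (simp add: z'_def)
        \<comment> \<open>Adding this to the descent estimate cancels the inner product with the
          current scaling \<open>?S (\<omega>, i)\<close>, which depends on \<open>i\<close>; what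
          remains is linear in \<open>?X i\<close> with constant coefficient
          \<open>?c\<close>.\<close>
        have "?c \<bullet> ?X i - \<alpha> t * (g t \<omega> \<bullet> vec_divide (?X i) (?S (\<omega>, i)))
            \<le> H\<^sup>2 * l1_norm (vec_divide (const_vec (\<alpha> t)) (?S (\<omega>, i)) - A (t - 1) \<omega>)"
          by (rule step_size_change_bound[OF norm_g[OF \<omega> t1]])
            (use A2[OF i xM'] in \<open>simp add: norm_vectorize\<close>)
        moreover have "f (?step (\<alpha> t) (x t \<omega>) (?l (\<omega>, i)) (?r (\<omega>, i)) (gradf i (x t \<omega>))) \<le>
            f (x t \<omega>) - \<alpha> t * (g t \<omega> \<bullet> vec_divide (?X i) (?S (\<omega>, i)))
            + L / 2 * (norm (vec_divide (\<alpha> t *\<^sub>R ?X i) (?S (\<omega>, i))))\<^sup>2"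
          unfolding g by (rule next_iterate_descent[OF manifold A1_smooth retraction A3 xM'])
        ultimately show "z' (\<omega>, i) + ?c \<bullet> ?X i \<le> Z t \<omega> + w (\<omega>, i)"
          by (simp add: z'_def w_def Z_def)
      qed
      then show ?thesis by (simp only: X(2) U_inner)
    qed
    have "(\<integral>\<^sup>+\<omega>. ennreal (z' (\<omega>, draw t \<omega>)) \<partial>P) + (\<integral>\<^sup>+\<omega>. ennreal (U t \<omega>) \<partial>P)
      \<le> (\<integral>\<^sup>+\<omega>. ennreal (Z t \<omega>) \<partial>P) + (\<integral>\<^sup>+\<omega>. ennreal (w (\<omega>, draw t \<omega>)) \<partial>P)"
    proof (rule P.nn_integral_fresh_step[where F = "?F t" and D = D and z' = "\<lambda>p. ennreal (z' p)" and w = "\<lambda>p. ennreal (w p)"])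
      show "(\<lambda>\<omega>. \<omega>) \<in> measurable P (?F t)" by (rule measP[where t = t]) simp
      show "draw t \<in> measurable P D" by (rule draw_meas[OF t1])
      show "distr P D (draw t) = D" by (rule draws_law[OF t1])
      show "P.prob (B \<inter> draw t -` C) = P.prob B * P.prob (draw t -` C \<inter> space P)"
        if "B \<in> sets (?F t)" "C \<in> sets D" for B C
        by (rule P.prob_past_draw[OF draws_indep t1 that])
    qed (use inner_step meas(1,4)[OF t1] in auto)
    then show ?thesis
      by (simp add: z'_draw w_draw cong: nn_integral_cong)
  qed

  \<comment> \<open>The first step and the constant\<close>
  define K where "K = 1 / (((1 - \<beta>) / real CARD('n)) powr (1/4) * ((1 - \<beta>) / real CARD('r)) powr (1/4))"
  \<comment> \<open>\<open>K\<close> bounds each entry of the first preconditioned gradient, so the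
    second summand bounds the negated linear term of step 1. Truncation at 0 makes \<open>C\<close>
    nonnegative, and no ingredient involves the horizon \<open>T\<close>.\<close>
  define C where "C = max 0 (f x\<^sub>1 - m + \<alpha> 1 * (real CARD('r \<times> 'n) * (H * K)))"
  have C_nonneg: "0 \<le> C" by (simp add: C_def)
  \<comment> \<open>Step 1 is estimated pointwise: \<open>S 1\<close> depends on the same draw as
    \<open>gt 1\<close>, so the linear term has no guaranteed sign, even on average.\<close>
  have first: "Z 2 \<omega> \<le> C + V 1 \<omega>" if \<omega>: "\<omega> \<in> space P" for \<omega>
  proof -
    have next_le: "next_l \<beta> (l 0 \<omega>) (?G 1 \<omega>) $ i \<le> lhat 1 \<omega> $ i" "next_r \<beta> (r 0 \<omega>) (?G 1 \<omega>) $ j \<le> rhat 1 \<omega> $ j" for i j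
      using run[OF \<omega>, of 1] by (simp_all add: vec_max_def)
    have "\<bar>vec_divide (gt 1 \<omega>) (S 1 \<omega>) $ k\<bar> \<le> K" for k
      unfolding K_def gt S_def vhat_eq
      by (rule preconditioned_component_bound[OF beta _ _ next_le]) (simp_all add: start[OF \<omega>])
    from neg_inner_le_card[OF norm_g[OF \<omega> order_refl] this]
    have "\<alpha> 1 * - (g 1 \<omega> \<bullet> vec_divide (gt 1 \<omega>) (S 1 \<omega>)) \<le> \<alpha> 1 * (real CARD('r \<times> 'n) * (H * K))"
      using step_sizes[of 1] by (intro mult_left_mono) auto
    moreover have "f (x 2 \<omega>) \<le> f (x 1 \<omega>) - \<alpha> 1 * (g 1 \<omega> \<bullet> vec_divide (gt 1 \<omega>) (S 1 \<omega>)) + V 1 \<omega>"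
      using next_iterate_descent[OF manifold A1_smooth retraction A3 xM[OF \<omega> order_refl]] run(5)[OF \<omega> order_refl]
      by (simp add: g gt S_def V_def vhat_eq numeral_2_eq_2)
    ultimately show ?thesis
      using start(1)[OF \<omega>] by (simp add: Z_def C_def)
  qed
  have Z2: "(\<integral>\<^sup>+\<omega>. ennreal (Z 2 \<omega>) \<partial>P) \<le> ennreal C + (\<integral>\<^sup>+\<omega>. ennreal (V 1 \<omega>) \<partial>P)"
  proof -
    have "(\<integral>\<^sup>+\<omega>. ennreal (Z 2 \<omega>) \<partial>P) \<le> (\<integral>\<^sup>+\<omega>. ennreal C + ennreal (V 1 \<omega>) \<partial>P)"
    proof (rule nn_integral_mono)
      fix \<omega> assume "\<omega> \<in> space P"
      then show "ennreal (Z 2 \<omega>) \<le> ennreal C + ennreal (V 1 \<omega>)"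
        unfolding ennreal_plus[OF C_nonneg nonneg(1), symmetric] by (intro ennreal_leI first)
    qed
    also have "\<dots> = ennreal C + (\<integral>\<^sup>+\<omega>. ennreal (V 1 \<omega>) \<partial>P)"
      by (subst nn_integral_add) (auto simp: P.emeasure_space_1)
    finally show ?thesis .
  qed

  \<comment> \<open>Gaps and gains stay on the left, so intermediate gaps are replaced rather than
    subtracted and infinite terms do no harm. At \<open>T = 1\<close> both sums are empty and
    \<open>Suc T\<close> is 2.\<close>
  have telescope: "(\<integral>\<^sup>+\<omega>. ennreal (Z (Suc T) \<omega>) \<partial>P) + (\<Sum>t=2..T. \<integral>\<^sup>+\<omega>. ennreal (U t \<omega>) \<partial>P)
      \<le> (\<integral>\<^sup>+\<omega>. ennreal (Z 2 \<omega>) \<partial>P) + (\<Sum>t=2..T. \<integral>\<^sup>+\<omega>. ennreal (W t \<omega>) \<partial>P)" if "1 \<le> T" for T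
    using that
  proof (induction T rule: dec_induct)
    case base
    then show ?case by (simp add: numeral_2_eq_2)
  next
    case (step T)
    let ?EZ = "\<lambda>t. \<integral>\<^sup>+\<omega>. ennreal (Z t \<omega>) \<partial>P" and ?EU = "\<lambda>t. \<integral>\<^sup>+\<omega>. ennreal (U t \<omega>) \<partial>P"
      and ?EW = "\<lambda>t. \<integral>\<^sup>+\<omega>. ennreal (W t \<omega>) \<partial>P"
    have "?EZ (Suc (Suc T)) + (\<Sum>t=2..Suc T. ?EU t) = (?EZ (Suc (Suc T)) + ?EU (Suc T)) + (\<Sum>t=2..T. ?EU t)"
      using step.hyps by (simp add: ac_simps)
    also have "\<dots> \<le> (?EZ (Suc T) + ?EW (Suc T)) + (\<Sum>t=2..T. ?EU t)"
      using step.hyps by (intro add_right_mono descent) simp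
    also have "\<dots> = (?EZ (Suc T) + (\<Sum>t=2..T. ?EU t)) + ?EW (Suc T)"
      by (simp add: ac_simps)
    also have "\<dots> \<le> (?EZ 2 + (\<Sum>t=2..T. ?EW t)) + ?EW (Suc T)"
      by (intro add_right_mono step.IH)
    also have "\<dots> = ?EZ 2 + (\<Sum>t=2..Suc T. ?EW t)"
      using step.hyps by (simp add: ac_simps)
    finally show ?case .
  qed

  show ?thesis
  proof (intro exI[of _ C] conjI allI impI)
    show "0 \<le> C" by (rule C_nonneg)
    fix T :: nat assume T: "1 \<le> T"
    have "(\<integral>\<^sup>+\<omega>. ennreal (\<Sum>t=2..T. U t \<omega>) \<partial>P) = (\<integral>\<^sup>+\<omega>. (\<Sum>t=2..T. ennreal (U t \<omega>)) \<partial>P)"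
      by (intro nn_integral_cong sum_ennreal[symmetric]) (simp add: U_nonneg)
    also have "\<dots> = (\<Sum>t=2..T. \<integral>\<^sup>+\<omega>. ennreal (U t \<omega>) \<partial>P)"
      by (rule nn_integral_sum) (use meas'(4) in auto)
    \<comment> \<open>The final gap is a nonnegative extended real and may be added.\<close>
    also have "\<dots> \<le> (\<integral>\<^sup>+\<omega>. ennreal (Z (Suc T) \<omega>) \<partial>P) + (\<Sum>t=2..T. \<integral>\<^sup>+\<omega>. ennreal (U t \<omega>) \<partial>P)"
      by simp
    also have "\<dots> \<le> (ennreal C + (\<integral>\<^sup>+\<omega>. ennreal (V 1 \<omega>) \<partial>P)) + (\<Sum>t=2..T. \<integral>\<^sup>+\<omega>. ennreal (W t \<omega>) \<partial>P)"
      by (rule order_trans[OF telescope[OF T]]) (rule add_right_mono[OF Z2])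
    also have "\<dots> = (\<integral>\<^sup>+\<omega>. ennreal (V 1 \<omega>) + (\<Sum>t=2..T. ennreal (W t \<omega>)) \<partial>P) + ennreal C"
    proof -
      have "(\<Sum>t=2..T. \<integral>\<^sup>+\<omega>. ennreal (W t \<omega>) \<partial>P) = (\<integral>\<^sup>+\<omega>. (\<Sum>t=2..T. ennreal (W t \<omega>)) \<partial>P)"
        by (rule nn_integral_sum[symmetric]) (use meas'(7) in auto)
      moreover have "(\<lambda>\<omega>. \<Sum>t=2..T. ennreal (W t \<omega>)) \<in> borel_measurable P"
        by (rule borel_measurable_sum) (use meas'(7) in auto)
      ultimately show ?thesis
        by (simp add: nn_integral_add ac_simps)
    qed
    also have "(\<lambda>\<omega>. ennreal (V 1 \<omega>) + (\<Sum>t=2..T. ennreal (W t \<omega>))) =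
        (\<lambda>\<omega>. ennreal ((\<Sum>t=1..T. V t \<omega>) + H\<^sup>2 * (\<Sum>t=2..T. l1_norm (A t \<omega> - A (t - 1) \<omega>))))"
    proof
      fix \<omega>
      \<comment> \<open>The term \<open>V 1\<close> left over from step 1 completes the sum of
        squares, while the l1 terms start at 2.\<close>
      have "(\<Sum>t=1..T. V t \<omega>) = V 1 \<omega> + (\<Sum>t=2..T. V t \<omega>)"
        using T by (simp add: sum.atLeast_Suc_atMost numeral_2_eq_2)
      then have "(\<Sum>t=1..T. V t \<omega>) + H\<^sup>2 * (\<Sum>t=2..T. l1_norm (A t \<omega> - A (t - 1) \<omega>)) = V 1 \<omega> + (\<Sum>t=2..T. W t \<omega>)"
        by (simp add: W_def sum.distrib sum_distrib_left)
      then show "ennreal (V 1 \<omega>) + (\<Sum>t=2..T. ennreal (W t \<omega>)) =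
          ennreal ((\<Sum>t=1..T. V t \<omega>) + H\<^sup>2 * (\<Sum>t=2..T. l1_norm (A t \<omega> - A (t - 1) \<omega>)))"
        using nonneg by (simp add: sum_ennreal sum_nonneg)
    qed
    finally show "(\<integral>\<^sup>+\<omega>. ennreal
          (\<Sum>t=2..T. \<alpha> (t - 1) * (g t \<omega> \<bullet> vec_divide (g t \<omega>) (vec_sqrt (vhat (t - 1) \<omega>)))) \<partial>P)
      \<le> (\<integral>\<^sup>+\<omega>. ennreal
          (L / 2 * (\<Sum>t=1..T. (norm (vec_divide (\<alpha> t *\<^sub>R gt t \<omega>) (vec_sqrt (vhat t \<omega>))))\<^sup>2)
           + H\<^sup>2 * (\<Sum>t=2..T. l1_norm
               (vec_divide (const_vec (\<alpha> t)) (vec_sqrt (vhat t \<omega>))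
                - vec_divide (const_vec (\<alpha> (t - 1))) (vec_sqrt (vhat (t - 1) \<omega>))))) \<partial>P)
        + ennreal C"
      by (simp only: U_def V_def A_def S_def sum_distrib_left)
  qed
qed

end
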